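(* Let $\beta=(\beta_1,\beta_2)\in(0,\infty)\times(1,\infty)$, $L>0$, and let $\bar\beta=2\beta_1\beta_2/(\beta_1+\beta_2)$. Assume that the design $(X,T)$ has a density $f_{(X,T)}$ with $h_1=\|f_{(X,T)}\|_\infty<\infty$. Then there exist a constant $c>0$ depending on $(\beta,L,h_1)$ and an integer $n_0$ such that for all $n\ge n_0$, $$\inf_{\widehat F_n}\ \sup_{F\in\mathcal B^\beta_{2,\infty}(A,L)}\mathbb E\left[n^{\bar\beta/(\bar\beta+1)}\|\widehat F_n-F\|^2\right]\ge c,$$ where the infimum is over all estimators $\widehat F_n$ measurable with respect to the sample $(X_i,T_i,\delta_i)_{i=1,\dots,n}$, the supremum is over conditional c.d.f.'s $F$ (i.e. $F(x,\cdot)$ is a c.d.f. of a positive variable for each $x$) whose restriction to $A$ belongs to $\mathcal B^\beta_{2,\infty}(A,L)$, and $\|\cdot\|$ is the $L^2(A)$ norm.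
   Context: Observation model: $(X_i,Y_i,T_i)_{i\le n}$ i.i.d., $Y_i,T_i>0$, $Y_i$ independent of $T_i$ conditionally on $X_i$, $\mathbb P[Y\le y\mid X=x]=F(x,y)$; one observes only $(X_i,T_i,\delta_i)$, $\delta_i=\mathbf 1_{\{Y_i\le T_i\}}$. The distribution of $(X_i,T_i)$ is fixed (it does not vary with $F$). $A=A_1\times A_2\subset\mathbb R\times\mathbb R^+$ is a product of nondegenerate compact intervals. Anisotropic Besov ball: for $f\in L^2(A)$, $j\in\{1,2\}$, $r\in\mathbb N^*$, $h>0$, $\Delta^r_{h,j}f(x,y)=\sum_{k=0}^r\binom rk(-1)^{r-k}f((x,y)+khe_j)$ on $A^r_{h,j}=\{z\in A: z+rhe_j\in A\}$ ($e_1,e_2$ canonical basis of $\mathbb R^2$); $\omega_{r,j}(f,t)=\sup_{|h|\le t}\|\Delta^r_{h,j}f\|_{L^2(A^r_{h,j})}$; with $r_j=\lfloor\beta_j\rfloor+1$, $|f|_{\mathcal B^\beta_{2,\infty}}=\sup_{t>0}[t^{-\beta_1}\omega_{r_1,1}(f,t)+t^{-\beta_2}\omega_{r_2,2}(f,t)]$, $\|f\|_{\mathcal B^\beta_{2,\infty}}=|f|_{\mathcal B^\beta_{2,\infty}}+\|f\|_{L^2(A)}$, and $\mathcal B^\beta_{2,\infty}(A,L)=\{f:\|f\|_{\mathcal B^\beta_{2,\infty}}\le L\}$. *)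

theory Defs
  imports "HOL-Probability.Probability"
begin

definition evec :: "nat \<Rightarrow> real \<times> real" where
  "evec j = (if j = 1 then (1, 0) else (0, 1))"

definition fdiff :: "nat \<Rightarrow> real \<Rightarrow> nat \<Rightarrow> (real \<times> real \<Rightarrow> real) \<Rightarrow> real \<times> real \<Rightarrow> real" where
  "fdiff r h j f z = (\<Sum>k = 0..r. real (r choose k) * (-1) ^ (r - k) * f (z + (real k * h) *\<^sub>R evec j))"

definition shift_dom :: "(real \<times> real) set \<Rightarrow> nat \<Rightarrow> real \<Rightarrow> nat \<Rightarrow> (real \<times> real) set" where
  "shift_dom A r h j = {z \<in> A. z + (real r * h) *\<^sub>R evec j \<in> A}"

definition L2norm :: "(real \<times> real) set \<Rightarrow> (real \<times> real \<Rightarrow> real) \<Rightarrow> ennreal" where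
  "L2norm S f = (let I = (\<integral>\<^sup>+ z \<in> S. ennreal ((f z)\<^sup>2) \<partial>lborel)
                 in if I = \<infinity> then \<infinity> else ennreal (sqrt (enn2real I)))"

definition modsmooth :: "(real \<times> real) set \<Rightarrow> nat \<Rightarrow> nat \<Rightarrow> (real \<times> real \<Rightarrow> real) \<Rightarrow> real \<Rightarrow> ennreal" where
  "modsmooth A r j f t = (SUP h \<in> {h. \<bar>h\<bar> \<le> t}. L2norm (shift_dom A r h j) (fdiff r h j f))"

definition besov_order :: "real \<Rightarrow> nat" where
  "besov_order b = nat \<lfloor>b\<rfloor> + 1"

definition besov_seminorm :: "(real \<times> real) set \<Rightarrow> real \<Rightarrow> real \<Rightarrow> (real \<times> real \<Rightarrow> real) \<Rightarrow> ennreal" where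
  "besov_seminorm A b1 b2 f =
     (SUP t \<in> {0<..}. ennreal (t powr (- b1)) * modsmooth A (besov_order b1) 1 f t
                     + ennreal (t powr (- b2)) * modsmooth A (besov_order b2) 2 f t)"

definition besov_norm :: "(real \<times> real) set \<Rightarrow> real \<Rightarrow> real \<Rightarrow> (real \<times> real \<Rightarrow> real) \<Rightarrow> ennreal" where
  "besov_norm A b1 b2 f = besov_seminorm A b1 b2 f + L2norm A f"

text \<open>Besov ball B^beta_{2,\<infinity>}(A,L): functions that are (Borel) measurable, in L^2(A) and of norm \<le> L.
  Only the values on A matter.\<close>
definition besov_ball :: "(real \<times> real) set \<Rightarrow> real \<Rightarrow> real \<Rightarrow> real \<Rightarrow> (real \<times> real \<Rightarrow> real) set" where
  "besov_ball A b1 b2 L = {f. f \<in> borel_measurable lborel \<and> besov_norm A b1 b2 f \<le> ennreal L}"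

definition cond_cdf :: "(real \<times> real \<Rightarrow> real) \<Rightarrow> bool" where
  "cond_cdf F \<longleftrightarrow> F \<in> borel_measurable lborel \<and>
     (\<forall>x. \<exists>M. real_distribution M \<and> measure M {..0} = 0 \<and> (\<forall>y. F (x, y) = cdf M y))"

definition design_density :: "(real \<times> real \<Rightarrow> real) \<Rightarrow> bool" where
  "design_density f \<longleftrightarrow> f \<in> borel_measurable lborel \<and> (\<forall>z. 0 \<le> f z) \<and>
     (\<integral>\<^sup>+ z. ennreal (f z) \<partial>lborel) = 1 \<and>
     (\<integral>\<^sup>+ z \<in> {z. snd z \<le> 0}. ennreal (f z) \<partial>lborel) = 0"

definition obs_space :: "((real \<times> real) \<times> bool) measure" where
  "obs_space = lborel \<Otimes>\<^sub>M count_space UNIV"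

text \<open>Law of one observation ((X,T),\<delta>) with \<delta> = 1{Y \<le> T}: (X,T) has density f and,
  given (X,T) = (x,t), \<delta> is Bernoulli with parameter F(x,t) (since Y is independent of T given X).\<close>
definition obs_law :: "(real \<times> real \<Rightarrow> real) \<Rightarrow> (real \<times> real \<Rightarrow> real) \<Rightarrow> ((real \<times> real) \<times> bool) measure" where
  "obs_law f F = density obs_space
     (\<lambda>(z, d). ennreal (f z * (if d then F z else 1 - F z)))"

definition sample_law :: "nat \<Rightarrow> (real \<times> real \<Rightarrow> real) \<Rightarrow> (real \<times> real \<Rightarrow> real)
    \<Rightarrow> (nat \<Rightarrow> (real \<times> real) \<times> bool) measure" where
  "sample_law n f F = (\<Pi>\<^sub>M i\<in>{..<n}. obs_law f F)"

definition estimators :: "nat \<Rightarrow> ((nat \<Rightarrow> (real \<times> real) \<times> bool) \<Rightarrow> real \<times> real \<Rightarrow> real) set" where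
  "estimators n = {G. (\<lambda>(\<omega>, z). G \<omega> z) \<in>
      borel_measurable ((\<Pi>\<^sub>M i\<in>{..<n}. obs_space) \<Otimes>\<^sub>M lborel)}"

definition risk :: "nat \<Rightarrow> (real \<times> real \<Rightarrow> real) \<Rightarrow> (real \<times> real) set
    \<Rightarrow> ((nat \<Rightarrow> (real \<times> real) \<times> bool) \<Rightarrow> real \<times> real \<Rightarrow> real) \<Rightarrow> (real \<times> real \<Rightarrow> real) \<Rightarrow> ennreal" where
  "risk n f A G F = (\<integral>\<^sup>+ \<omega>. (\<integral>\<^sup>+ z \<in> A. ennreal ((G \<omega> z - F z)\<^sup>2) \<partial>lborel) \<partial>sample_law n f F)"

end

theory Submission
  imports Defs
begin

text \<open>
  Assouad's method. The base conditional c.d.f. is \<open>\<epsilon> y\<close> up to \<open>b2 + 1\<close> and \<open>1\<close> afterwards; since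
  \<open>\<beta>2 > 1\<close>, both Besov difference orders annihilate it on \<open>A\<close>, so only its small \<open>L\<^sup>2\<close> norm counts.
  On the upper half of \<open>A\<close>, where the base stays away from \<open>0\<close> and \<open>1\<close>, one adds any subset of a grid of
  tensor bumps of height \<open>a \<asymp> \<sigma>\<close> and side lengths \<open>H1 \<asymp> \<sigma>\<^bsup>1/\<beta>1\<^esup>\<close>, \<open>H2 \<asymp> \<sigma>\<^bsup>1/\<beta>2\<^esup>\<close>. The result stays
  in the Besov ball, and it stays increasing in \<open>y\<close> because its slope changes by at most
  \<open>O(\<sigma>\<^bsup>1 - 1/\<beta>2\<^esup>)\<close>. Toggling one bump changes the law of one observation by a chi-square divergence
  of order \<open>\<sigma>\<^sup>2 H1 H2\<close>, which is \<open>1/n\<close> for \<open>\<sigma> = n\<^bsup>-1/(2 + 1/\<beta>1 + 1/\<beta>2)\<^esup>\<close>; so a fixed fraction of the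
  bumps cannot be detected and the risk is of order \<open>\<sigma>\<^sup>2 = n\<^bsup>-\<beta>bar/(\<beta>bar + 1)\<^esup>\<close>.
\<close>

section \<open>Finite differences\<close>

text \<open>One-variable form of \<open>fdiff\<close>: the estimates are made for
  \<open>ndiff\<close> and carried over to the two coordinate directions by \<open>fdiff_1\<close>
  and \<open>fdiff_2\<close>.\<close>

definition ndiff :: "nat \<Rightarrow> real \<Rightarrow> (real \<Rightarrow> real) \<Rightarrow> real \<Rightarrow> real" where
  "ndiff r h g x = (\<Sum>k = 0..r. real (r choose k) * (-1) ^ (r - k) * g (x + real k * h))"

lemma ndiff_0 [simp]: "ndiff 0 h g x = g x"
  by (simp add: ndiff_def)

text \<open>Pascal's rule. The extra first difference acts on the function rather than outside,
  which suits an induction on \<open>r\<close> with \<open>g\<close> arbitrary.\<close>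

lemma ndiff_Suc: "ndiff (Suc r) h g x = ndiff r h (\<lambda>y. g (y + h) - g y) x"
proof -
  \<comment> \<open>Both sums are padded to \<open>{0..Suc r}\<close>: the guard at
    \<open>k = 0\<close> shields the truncated \<open>k - 1\<close>, and in the second sum the new
    term vanishes because \<open>r choose Suc r\<close> is \<open>0\<close>.\<close>
  have 1: "(\<Sum>k = 0..r. real (r choose k) * (-1) ^ (r - k) * g (x + real (Suc k) * h))
      = (\<Sum>k = 0..Suc r. (if k = 0 then 0 else real (r choose (k - 1)) * (-1) ^ (Suc r - k) * g (x + real k * h)))"
    by (subst sum.atLeast0_atMost_Suc_shift) simp
  have 2: "(\<Sum>k = 0..r. real (r choose k) * (-1) ^ (r - k) * g (x + real k * h))
      = (\<Sum>k = 0..Suc r. - (real (r choose k) * (-1) ^ (Suc r - k) * g (x + real k * h)))"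
    by (simp add: Suc_diff_le)
  have "ndiff r h (\<lambda>y. g (y + h) - g y) x
      = (\<Sum>k = 0..r. real (r choose k) * (-1) ^ (r - k) * g (x + real (Suc k) * h))
        - (\<Sum>k = 0..r. real (r choose k) * (-1) ^ (r - k) * g (x + real k * h))"
    by (simp add: ndiff_def sum_subtractf[symmetric] algebra_simps)
  also have "\<dots> = (\<Sum>k = 0..Suc r. real (Suc r choose k) * (-1) ^ (Suc r - k) * g (x + real k * h))"
    unfolding 1 2 sum_subtractf[symmetric]
  proof (rule sum.cong)
    fix k assume "k \<in> {0..Suc r}"
    then show "(if k = 0 then 0 else real (r choose (k - 1)) * (-1) ^ (Suc r - k) * g (x + real k * h))
        - - (real (r choose k) * (-1) ^ (Suc r - k) * g (x + real k * h))
        = real (Suc r choose k) * (-1) ^ (Suc r - k) * g (x + real k * h)"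
      by (cases k) (simp_all add: algebra_simps)
  qed simp
  finally show ?thesis by (simp add: ndiff_def)
qed

lemma abs_diff_le_of_deriv_bound:
  fixes f f' :: "real \<Rightarrow> real"
  assumes "\<And>x. (f has_real_derivative f' x) (at x)" and "\<And>x. \<bar>f' x\<bar> \<le> M"
  shows "\<bar>f (x + h) - f x\<bar> \<le> \<bar>h\<bar> * M"
  using field_differentiable_bound[of UNIV f f' M x "x + h"] assms
  by (simp add: abs_minus_commute mult.commute)

text \<open>The family \<open>g\<close> stands for a function followed by its derivatives. Its
  increments \<open>g k (y + h) - g k y\<close> form such a family with one order less, and the mean
  value bound turns \<open>M\<close> into \<open>\<bar>h\<bar> * M\<close>.\<close>

lemma abs_ndiff_le_of_deriv_bound:
  assumes "\<And>k x. k < r \<Longrightarrow> (g k has_real_derivative g (Suc k) x) (at x)"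
    and "\<And>x. \<bar>g r x\<bar> \<le> M"
  shows "\<bar>ndiff r h (g 0) x\<bar> \<le> \<bar>h\<bar> ^ r * M"
  using assms
proof (induction r arbitrary: g M x)
  case 0
  then show ?case by simp
next
  case (Suc r)
  have "\<bar>ndiff r h ((\<lambda>k y. g k (y + h) - g k y) 0) x\<bar> \<le> \<bar>h\<bar> ^ r * (\<bar>h\<bar> * M)"
  proof (rule Suc.IH)
    fix k x assume "k < r"
    then have d: "(g k has_real_derivative g (Suc k) x) (at x)" for x
      by (intro Suc.prems(1)) simp
    have "((\<lambda>y. g k (y + h)) has_real_derivative g (Suc k) (x + h)) (at x)"
      using d[of "x + h"] by (simp add: DERIV_shift)
    then show "((\<lambda>y. g k (y + h) - g k y) has_real_derivative g (Suc k) (x + h) - g (Suc k) x) (at x)"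
      by (intro DERIV_diff d)
  next
    fix x show "\<bar>g r (x + h) - g r x\<bar> \<le> \<bar>h\<bar> * M"
      by (rule abs_diff_le_of_deriv_bound[where f' = "g (Suc r)"]) (use Suc.prems in auto)
  qed
  then show ?case by (simp add: ndiff_Suc mult.assoc mult.commute mult.left_commute)
qed

lemma abs_ndiff_le_of_bound:
  assumes "\<And>x. \<bar>g x\<bar> \<le> B"
  shows "\<bar>ndiff r h g x\<bar> \<le> 2 ^ r * B"
proof -
  have "\<bar>ndiff r h g x\<bar> \<le> (\<Sum>k = 0..r. real (r choose k) * B)"
    unfolding ndiff_def
    by (rule order_trans[OF sum_abs]) (auto simp: abs_mult intro!: sum_mono mult_left_mono assms)
  also have "\<dots> = real (\<Sum>k\<le>r. r choose k) * B"
    by (simp add: sum_distrib_right atLeast0AtMost)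
  also have "\<dots> = 2 ^ r * B" by (simp add: choose_row_sum)
  finally show ?thesis .
qed

lemma ndiff_add: "ndiff r h (\<lambda>x. f x + g x) x = ndiff r h f x + ndiff r h g x"
  by (simp add: ndiff_def sum.distrib algebra_simps)

text \<open>Constants, and in the next lemma linear functions, have a vanishing derivative of order
  \<open>r\<close>, so the derivative bound applies with \<open>M = 0\<close>. This removes the base
  function from the Besov seminorm.\<close>

lemma ndiff_const: "1 \<le> r \<Longrightarrow> ndiff r h (\<lambda>x. c) x = 0"
  using abs_ndiff_le_of_deriv_bound[of r "\<lambda>k x. if k = 0 then c else 0" 0 h x] by auto

lemma ndiff_linear: "2 \<le> r \<Longrightarrow> ndiff r h (\<lambda>x. c * x) x = 0"
  using abs_ndiff_le_of_deriv_bound[of r "\<lambda>k x. if k = 0 then c * x else if k = 1 then c else 0" 0 h x]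
  by (auto intro!: derivative_eq_intros)

lemma ndiff_cong:
  "(\<And>k. k \<le> r \<Longrightarrow> f (x + real k * h) = g (x + real k * h)) \<Longrightarrow> ndiff r h f x = ndiff r h g x"
  unfolding ndiff_def by (intro sum.cong) auto

lemma fdiff_1: "fdiff r h 1 f (x, y) = ndiff r h (\<lambda>x. f (x, y)) x"
  by (simp add: fdiff_def ndiff_def evec_def)

lemma fdiff_2: "fdiff r h 2 f (x, y) = ndiff r h (\<lambda>y. f (x, y)) y"
  by (simp add: fdiff_def ndiff_def evec_def)


section \<open>Sums of translated bumps\<close>

text \<open>The half-open cut-off gives disjoint supports to the integer translates, so that at most
  one of them is nonzero at a given point.\<close>

definition bump :: "real poly \<Rightarrow> real \<Rightarrow> real" where
  "bump p u = (if 0 \<le> u \<and> u < 1 then poly p u else 0)"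

text \<open>One-sided derivatives are glued. Just to the right of any point a single formula holds,
  by the half-open cut-off; to the left, the zeros of \<open>p\<close> and \<open>pderiv p\<close>
  at \<open>0\<close> and \<open>1\<close> reconcile the two formulas at the break points.\<close>

lemma DERIV_bump:
  assumes p: "poly p 0 = 0" "poly p 1 = 0" and p': "poly (pderiv p) 0 = 0" "poly (pderiv p) 1 = 0"
  shows "(bump p has_real_derivative bump (pderiv p) u) (at u)"
proof -
  have P: "(poly p has_real_derivative poly (pderiv p) u) (at u within S)" for S u
    by (rule has_field_derivative_at_within[OF poly_DERIV])
  have Z: "((\<lambda>_. 0::real) has_real_derivative 0) (at u within S)" for S u
    by simp
  have loc: "(bump p has_real_derivative D) (at u within S)"
    if "(f has_real_derivative D) (at u within S)" "0 < d" "u \<in> S"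
      and "\<And>x. x \<in> S \<Longrightarrow> \<bar>x - u\<bar> < d \<Longrightarrow> f x = bump p x" for f D S d
    by (rule has_field_derivative_transform_within[OF that(1,2,3)]) (simp add: that(4) dist_real_def)
  have right: "(bump p has_real_derivative bump (pderiv p) u) (at u within {u..})"
  proof -
    consider "u < 0" | "0 \<le> u \<and> u < 1" | "1 \<le> u" by linarith
    then show ?thesis
    proof cases
      case 1
      show ?thesis by (rule loc[of "\<lambda>_. 0" _ _ "-u"]) (use 1 in \<open>auto simp: bump_def\<close>)
    next
      case 2
      show ?thesis by (rule loc[of "poly p" _ _ "1-u"]) (use 2 P in \<open>auto simp: bump_def\<close>)
    next
      case 3
      show ?thesis by (rule loc[of "\<lambda>_. 0" _ _ "1"]) (use 3 in \<open>auto simp: bump_def\<close>)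
    qed
  qed
  have left: "(bump p has_real_derivative bump (pderiv p) u) (at u within {..u})"
  proof -
    consider "u \<le> 0" | "0 < u \<and> u \<le> 1" | "1 < u" by linarith
    then show ?thesis
    proof cases
      case 1
      have "bump p x = 0 \<and> bump (pderiv p) x = 0" if "x \<le> 0" for x
        using that p p' by (cases "x = 0") (simp_all add: bump_def)
      with 1 show ?thesis by (intro loc[of "\<lambda>_. 0" _ _ "1"]) auto
    next
      case 2
      have "(poly p has_real_derivative bump (pderiv p) u) (at u within {..u})"
        using P[of u] 2 p'(2) by (cases "u = 1") (auto simp: bump_def)
      then show ?thesis
        by (rule loc[where d=u]) (use 2 p in \<open>auto simp: bump_def not_less dest!: antisym\<close>)
    next
      case 3
      show ?thesis by (rule loc[of "\<lambda>_. 0" _ _ "u-1"]) (use 3 in \<open>auto simp: bump_def\<close>)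
    qed
  qed
  have "(bump p has_real_derivative bump (pderiv p) u) (at u within {..u} \<union> {u..})"
    using left right unfolding has_field_derivative_iff Lim_within_Un by simp
  moreover have "{..u} \<union> {u..} = UNIV" by auto
  ultimately show ?thesis by simp
qed

section \<open>Orders of vanishing of polynomials and a bump of finite smoothness\<close>

lemma power_dvd_pderiv:
  fixes q :: "real poly"
  assumes "q ^ Suc m dvd p" shows "q ^ m dvd pderiv p"
proof -
  from assms obtain s where "p = q ^ Suc m * s" by blast
  then have "pderiv p = q ^ m * (q * pderiv s + smult (of_nat (Suc m)) (pderiv q) * s)"
    by (simp only: pderiv_mult pderiv_power_Suc) (simp add: algebra_simps)
  then show ?thesis by simp
qed

text \<open>Each differentiation lowers the multiplicity of a factor by at most one; from
  \<open>k = m\<close> on the truncated exponent is \<open>0\<close> and the claim is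
  trivial.\<close>

lemma power_dvd_higher_pderiv:
  fixes q :: "real poly"
  assumes "q ^ m dvd p" shows "q ^ (m - k) dvd (pderiv ^^ k) p"
proof (induction k)
  case (Suc k)
  show ?case
  proof (cases "k < m")
    case True
    then have "m - k = Suc (m - Suc k)" by simp
    with Suc show ?thesis using power_dvd_pderiv by simp
  next
    case False then show ?thesis by simp
  qed
qed (use assms in simp)

text \<open>The Besov norm only involves differences of finite order, so \<open>r\<close>
  derivatives are enough and a polynomial cut off to the unit interval will do.\<close>

lemma ex_smooth_bump:
  obtains g :: "nat \<Rightarrow> real \<Rightarrow> real" and M m0 :: real where
    "\<And>k u. k < r \<Longrightarrow> (g k has_real_derivative g (Suc k) u) (at u)"
    "\<And>k u. g k u \<noteq> 0 \<Longrightarrow> 0 \<le> u \<and> u < 1"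
    "\<And>k u. k \<le> r \<Longrightarrow> \<bar>g k u\<bar> \<le> M" "1 \<le> M"
    "\<And>u. 0 \<le> g 0 u" "\<And>u. g 0 u \<le> 1"
    "\<And>u. 1/4 \<le> u \<Longrightarrow> u \<le> 3/4 \<Longrightarrow> m0 \<le> g 0 u" "0 < m0"
proof -
  \<comment> \<open>Zeros of order \<open>r + 1\<close> at \<open>0\<close> and \<open>1\<close>
    make all derivatives up to order \<open>r\<close> vanish there, so \<open>DERIV_bump\<close>
    applies at every stage \<open>k < r\<close>.\<close>
  define p where "p = ([:0, 1:] * [:1, -1:] :: real poly) ^ (r + 1)"
  define g where "g k = bump ((pderiv ^^ k) p)" for k
  have z: "poly ((pderiv ^^ k) p) 0 = 0 \<and> poly ((pderiv ^^ k) p) 1 = 0" if "k \<le> r" for k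
  proof -
    have "[:0, 1:] ^ (r + 1) dvd p" "[:1, -1:] ^ (r + 1) dvd p"
      by (simp_all only: p_def power_mult_distrib dvd_triv_left dvd_triv_right)
    from this[THEN power_dvd_higher_pderiv[where k=k]]
    have "[:0, 1:] ^ Suc (r - k) dvd (pderiv ^^ k) p" "[:1, -1:] ^ Suc (r - k) dvd (pderiv ^^ k) p"
      using that by (simp_all add: Suc_diff_le)
    then obtain s t where "(pderiv ^^ k) p = [:0, 1:] * s" "(pderiv ^^ k) p = [:1, -1:] * t"
      by (auto simp only: power_Suc mult.assoc elim!: dvdE)
    then have "poly ((pderiv ^^ k) p) 0 = poly ([:0, 1:] * s) 0"
      "poly ((pderiv ^^ k) p) 1 = poly ([:1, -1:] * t) 1" by simp_all
    then show ?thesis by simp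
  qed
  have "\<exists>M. \<forall>u\<in>{0..1}. \<bar>poly ((pderiv ^^ k) p) u\<bar> \<le> M" for k
  proof -
    have "compact (poly ((pderiv ^^ k) p) ` {0..1})"
      by (intro compact_continuous_image continuous_intros) auto
    then show ?thesis using compact_imp_bounded bounded_real by (metis imageI)
  qed
  then obtain B where B: "\<And>k u. u \<in> {0..1} \<Longrightarrow> \<bar>poly ((pderiv ^^ k) p) u\<bar> \<le> B k" by metis
  define M where "M = 1 + (\<Sum>k\<le>r. \<bar>B k\<bar>)"
  have gp: "g 0 u = (if 0 \<le> u \<and> u < 1 then (u * (1 - u)) ^ (r + 1) else 0)" for u
    by (simp add: g_def bump_def p_def poly_power del: power_Suc)
  show ?thesis
  \<comment> \<open>On the middle half both \<open>u\<close> and \<open>1 - u\<close> are at least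
    \<open>1/4\<close>, whence the value chosen for \<open>m0\<close>.\<close>
  proof (rule that[of g M "(1/16) ^ (r + 1)"])
    fix k u assume "k < r"
    then show "(g k has_real_derivative g (Suc k) u) (at u)"
      unfolding g_def using z[of k] z[of "Suc k"] DERIV_bump[of "(pderiv ^^ k) p" u] by simp
  next
    fix k u assume "g k u \<noteq> 0" then show "0 \<le> u \<and> u < 1"
      by (simp add: g_def bump_def split: if_splits)
  next
    fix k u assume "k \<le> r"
    then have "\<bar>B k\<bar> \<le> (\<Sum>k\<le>r. \<bar>B k\<bar>)" by (intro member_le_sum) auto
    moreover have "0 \<le> (\<Sum>k\<le>r. \<bar>B k\<bar>)" by (intro sum_nonneg) auto
    moreover have "\<bar>g k u\<bar> \<le> \<bar>B k\<bar>"
      using B[of u k] by (auto simp: g_def bump_def)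
    ultimately show "\<bar>g k u\<bar> \<le> M" by (simp add: M_def)
  next
    show "1 \<le> M" by (simp add: M_def sum_nonneg)
  next
    fix u show "0 \<le> g 0 u" by (simp add: gp)
  next
    fix u show "g 0 u \<le> 1"
      unfolding gp by (auto intro!: power_le_one mult_le_one simp del: power_Suc power_add)
  next
    fix u :: real assume "1/4 \<le> u" "u \<le> 3/4"
    moreover from this have "1/4 * (1/4) \<le> u * (1 - u)" by (intro mult_mono) auto
    ultimately show "(1/16) ^ (r + 1) \<le> g 0 u" unfolding gp by (auto intro!: power_mono simp del: power_Suc)
  qed simp
qed


lemma ndiff_cmult: "ndiff r h (\<lambda>x. c * g x) x = c * ndiff r h g x"
  by (simp add: ndiff_def sum_distrib_left mult_ac)

section \<open>One-dimensional combinations of integer translates of a bump\<close>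

locale smooth_bump =
  fixes g :: "nat \<Rightarrow> real \<Rightarrow> real" and r :: nat and M m0 :: real
  assumes g_deriv: "\<And>k u. k < r \<Longrightarrow> (g k has_real_derivative g (Suc k) u) (at u)"
    and g_supp: "\<And>k u. g k u \<noteq> 0 \<Longrightarrow> 0 \<le> u \<and> u < 1"
    and g_bound: "\<And>k u. k \<le> r \<Longrightarrow> \<bar>g k u\<bar> \<le> M"
    and M_ge_1: "1 \<le> M"
    and g_nonneg: "\<And>u. 0 \<le> g 0 u"
    and g_le_1: "\<And>u. g 0 u \<le> 1"
    and g_low: "\<And>u. 1/4 \<le> u \<Longrightarrow> u \<le> 3/4 \<Longrightarrow> m0 \<le> g 0 u"
    and m0_pos: "0 < m0"
    and r_ge: "2 \<le> r"
begin

definition wave :: "nat \<Rightarrow> nat \<Rightarrow> (nat \<Rightarrow> real) \<Rightarrow> real \<Rightarrow> real" where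
  "wave k N c u = (\<Sum>i<N. c i * g k (u - real i))"

text \<open>Only the translate with index \<open>\<lfloor>u\<rfloor>\<close> can be nonzero at
  \<open>u\<close>. Bounds on the coefficients therefore pass to the sum with no factor
  \<open>N\<close>.\<close>

lemma wave_single:
  "wave k N c u = (if 0 \<le> u \<and> nat \<lfloor>u\<rfloor> < N then c (nat \<lfloor>u\<rfloor>) * g k (u - real (nat \<lfloor>u\<rfloor>)) else 0)"
proof -
  have *: "c i * g k (u - real i) = (if 0 \<le> u \<and> i = nat \<lfloor>u\<rfloor> then c i * g k (u - real i) else 0)" for i
  proof (cases "g k (u - real i) = 0")
    case True then show ?thesis by (simp only: mult_zero_right if_cancel)
  next
    case False
    from g_supp[OF this] have "0 \<le> u" "\<lfloor>u\<rfloor> = int i" by linarith+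
    then show ?thesis by simp
  qed
  show ?thesis
  proof (cases "0 \<le> u")
    case True
    then show ?thesis unfolding wave_def by (subst *) simp
  next
    case False
    then show ?thesis unfolding wave_def by (subst *) simp
  qed
qed

lemma wave_bound:
  assumes "\<And>i. \<bar>c i\<bar> \<le> B" "\<And>u. \<bar>g k u\<bar> \<le> K"
  shows "\<bar>wave k N c u\<bar> \<le> B * K"
proof -
  have "0 \<le> B" "0 \<le> K" using assms[of 0] by (meson abs_ge_zero order_trans)+
  then show ?thesis
    unfolding wave_single by (auto simp: abs_mult intro!: mult_mono assms)
qed

lemma wave_bound_0:
  assumes "\<And>i. \<bar>c i\<bar> \<le> B"
  shows "\<bar>wave 0 N c u\<bar> \<le> B"
  using wave_bound[of c B 0 1] assms g_nonneg g_le_1 by simp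

lemma wave_deriv:
  assumes "k < r"
  shows "((\<lambda>x. wave k N c ((x - x0) / H)) has_real_derivative wave (Suc k) N c ((x - x0) / H) / H) (at x)"
proof -
  have *: "((\<lambda>x. g k ((x - x0) / H - real i)) has_real_derivative g (Suc k) ((x - x0) / H - real i) / H) (at x)" for i
  proof -
    have "((\<lambda>x. (x - x0) / H - real i) has_real_derivative 1 / H) (at x)"
      by (auto intro!: derivative_eq_intros simp: divide_inverse)
    from DERIV_chain2[OF g_deriv[OF assms] this] show ?thesis by simp
  qed
  have "((\<lambda>x. \<Sum>i<N. c i * g k ((x - x0) / H - real i)) has_real_derivative
        (\<Sum>i<N. c i * (g (Suc k) ((x - x0) / H - real i) / H))) (at x)"
    by (intro DERIV_sum DERIV_cmult *)
  then show ?thesis by (simp add: wave_def sum_divide_distrib)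
qed

lemma wave_ndiff:
  assumes "s \<le> r" "0 < H" "\<And>i. \<bar>c i\<bar> \<le> 1"
  shows "\<bar>ndiff s h (\<lambda>x. wave 0 N c ((x - x0) / H)) x\<bar> \<le> M * (\<bar>h\<bar> / H) ^ s"
proof -
  \<comment> \<open>The tower of derivatives of the rescaled wave: each differentiation brings out a
    factor \<open>1 / H\<close>.\<close>
  let ?w = "\<lambda>k x. wave k N c ((x - x0) / H) / H ^ k"
  have "\<bar>ndiff s h (?w 0) x\<bar> \<le> \<bar>h\<bar> ^ s * (M / H ^ s)"
  proof (rule abs_ndiff_le_of_deriv_bound)
    fix k x assume "k < s"
    then have "k < r" using assms by simp
    from DERIV_cdivide[OF wave_deriv[OF this, of N c x0 H x], of "H ^ k"]
    show "(?w k has_real_derivative ?w (Suc k) x) (at x)" by (simp add: mult_ac)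
  next
    fix x show "\<bar>?w s x\<bar> \<le> M / H ^ s"
      using wave_bound[of c 1 s M N "(x - x0) / H"] assms g_bound[of s]
      by (simp add: divide_right_mono)
  qed
  then show ?thesis by (simp add: power_divide mult_ac)
qed

lemma g_continuous: "continuous_on UNIV (g 0)"
  using g_deriv[of 0] r_ge by (intro DERIV_continuous_on) (auto intro: has_field_derivative_at_within)

lemma g_measurable [measurable]: "g 0 \<in> borel_measurable borel"
  using g_continuous by (rule borel_measurable_continuous_onI)

end

section \<open>Perturbed conditional distribution functions\<close>

text \<open>The grid fills \<open>{a1..b1} \<times> {y0..b2}\<close>. The assumption
  \<open>slope\<close> lets the base slope \<epsilon> absorb the steepest descent
  \<open>a * M / H2\<close> of a bump, and \<open>\<epsilon>_le\<close> keeps the base at most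
  \<open>1/2\<close> up to \<open>b2 + 1\<close>.\<close>

locale perturbation = smooth_bump +
  fixes a1 b1 y0 b2 a \<epsilon> :: real and N1 N2 :: nat
  assumes x_less: "a1 < b1" and y0_pos: "0 < y0" and y_less: "y0 < b2"
    and N_pos: "0 < N1" "0 < N2" and a_nonneg: "0 \<le> a" and \<epsilon>_pos: "0 < \<epsilon>"
    and slope: "a * M * (N2 / (b2 - y0)) \<le> \<epsilon>"
    and \<epsilon>_le: "\<epsilon> * (b2 + 1) \<le> 1/2"
begin

definition H1 :: real where "H1 = (b1 - a1) / N1"
definition H2 :: real where "H2 = (b2 - y0) / N2"
definition cells :: "(nat \<times> nat) set" where "cells = {..<N1} \<times> {..<N2}"

text \<open>The set \<open>S\<close> is a vertex of the Assouad hypercube: it selects the cells that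
  carry a bump. The Boolean weight inside a full double sum allows the expression to be read as a
  wave in either variable.\<close>

definition pert :: "(nat \<times> nat) set \<Rightarrow> real \<times> real \<Rightarrow> real" where
  "pert S z = (\<Sum>i<N1. \<Sum>j<N2.
     of_bool ((i, j) \<in> S) * (a * (g 0 ((fst z - a1) / H1 - real i) * g 0 ((snd z - y0) / H2 - real j))))"

lemma H_pos: "0 < H1" "0 < H2"
  using x_less y_less N_pos by (auto simp: H1_def H2_def)

lemma finite_cells: "finite cells" by (simp add: cells_def)

lemma card_cells: "card cells = N1 * N2" by (simp add: cells_def card_cartesian_product)

text \<open>With \<open>y\<close> frozen the inner waves act as coefficients of absolute value at
  most 1, so the one-dimensional bounds apply in \<open>x\<close>; \<open>pert_wave2\<close> does
  the same in \<open>y\<close> after exchanging the sums.\<close>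

lemma pert_wave1: "pert S (x, y) = a * wave 0 N1
    (\<lambda>i. wave 0 N2 (\<lambda>j. of_bool ((i, j) \<in> S)) ((y - y0) / H2)) ((x - a1) / H1)"
  unfolding pert_def wave_def
  by (simp add: sum_distrib_left sum_distrib_right mult_ac del: sum_mult_of_bool_eq sum_of_bool_mult_eq)

lemma pert_wave2: "pert S (x, y) = a * wave 0 N2
    (\<lambda>j. wave 0 N1 (\<lambda>i. of_bool ((i, j) \<in> S)) ((x - a1) / H1)) ((y - y0) / H2)"
  unfolding pert_def wave_def
  by (subst sum.swap) (simp add: sum_distrib_left sum_distrib_right mult_ac del: sum_mult_of_bool_eq sum_of_bool_mult_eq)

lemma wave_of_bool: "\<bar>wave 0 N (\<lambda>i. of_bool (P i)) u\<bar> \<le> 1"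
  by (rule wave_bound_0) auto

lemma pert_measurable [measurable]: "pert S \<in> borel_measurable (borel \<Otimes>\<^sub>M borel)"
  unfolding pert_def by measurable

lemma pert_nonneg: "0 \<le> pert S z"
  unfolding pert_def by (intro sum_nonneg mult_nonneg_nonneg a_nonneg g_nonneg) auto

lemma pert_le: "pert S z \<le> a"
proof -
  have w: "wave 0 N1 c u \<le> 1" if "\<And>i. \<bar>c i\<bar> \<le> 1" for c u
    using wave_bound_0[of c 1 N1 u] that by auto
  have "a * wave 0 N1 (\<lambda>i. wave 0 N2 (\<lambda>j. of_bool ((i, j) \<in> S)) ((snd z - y0) / H2)) ((fst z - a1) / H1) \<le> a * 1"
    by (intro mult_left_mono a_nonneg) (auto intro!: wave_of_bool w)
  then show ?thesis using pert_wave1[of S "fst z" "snd z"] by simp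
qed

lemma pert_insert:
  assumes "k \<notin> S" shows "pert (insert k S) z = pert S z + pert {k} z"
proof -
  have "of_bool (p \<in> insert k S) = (of_bool (p \<in> S) + of_bool (p \<in> {k}) :: real)" for p
    using assms by auto
  then show ?thesis
    unfolding pert_def sum.distrib[symmetric]
    by (intro sum.cong refl) (simp only: distrib_right)
qed

lemma pert_singleton:
  assumes "i < N1" "j < N2"
  shows "pert {(i, j)} z = a * (g 0 ((fst z - a1) / H1 - real i) * g 0 ((snd z - y0) / H2 - real j))"
proof -
  let ?G = "\<lambda>i j. a * (g 0 ((fst z - a1) / H1 - real i) * g 0 ((snd z - y0) / H2 - real j))"
  have "pert {(i, j)} z = (\<Sum>i'<N1. if i' = i then \<Sum>j'<N2. if j' = j then ?G i' j' else 0 else 0)"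
    unfolding pert_def by (intro sum.cong refl) (auto intro!: sum.neutral sum.cong)
  then show ?thesis using assms by simp
qed

lemma pert_ndiff1:
  assumes "s \<le> r"
  shows "\<bar>ndiff s h (\<lambda>x. pert S (x, y)) x\<bar> \<le> a * (M * (\<bar>h\<bar> / H1) ^ s)"
  unfolding pert_wave1 ndiff_cmult abs_mult using a_nonneg
  by (auto intro!: mult_left_mono wave_ndiff assms H_pos wave_of_bool)

lemma pert_ndiff2:
  assumes "s \<le> r"
  shows "\<bar>ndiff s h (\<lambda>y. pert S (x, y)) y\<bar> \<le> a * (M * (\<bar>h\<bar> / H2) ^ s)"
  unfolding pert_wave2 ndiff_cmult abs_mult using a_nonneg
  by (auto intro!: mult_left_mono wave_ndiff assms H_pos wave_of_bool)

text \<open>Crude companion of the two preceding bounds, for steps \<open>h\<close> that are long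
  compared with the width of a bump.\<close>

lemma pert_ndiff_sup:
  "\<bar>ndiff s h (\<lambda>x. pert S (x, y)) x\<bar> \<le> a * 2 ^ s"
  "\<bar>ndiff s h (\<lambda>y. pert S (x, y)) y\<bar> \<le> a * 2 ^ s"
  using abs_ndiff_le_of_bound[of "\<lambda>x. pert S (x, y)" a] abs_ndiff_le_of_bound[of "\<lambda>y. pert S (x, y)" a]
    pert_nonneg pert_le by (simp_all add: mult_ac)

text \<open>The support condition on \<open>g\<close> settles everything except the endpoint
  \<open>y0\<close>, where \<open>g 0 0 = 0\<close> is needed; it follows by continuity, since
  \<open>g 0\<close> vanishes to the left of \<open>0\<close>.\<close>

lemma pert_zero:
  assumes "snd z \<le> y0 \<or> b2 \<le> snd z"
  shows "pert S z = 0"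
proof -
  have "g 0 ((snd z - y0) / H2 - real j) = 0" if "j < N2" for j
  proof (rule ccontr)
    let ?u = "(snd z - y0) / H2 - real j"
    assume nz: "g 0 ?u \<noteq> 0"
    have 0: "g 0 0 = 0"
    proof (rule ccontr)
      assume "g 0 0 \<noteq> 0"
      moreover have "\<forall>\<^sub>F u in at_left 0. g 0 u = 0"
        unfolding eventually_at_left_field
        using g_supp[of 0] by (metis lt_ex not_le)
      then have "(g 0 \<longlongrightarrow> 0) (at_left 0)" by (rule tendsto_eventually)
      moreover have "(g 0 \<longlongrightarrow> g 0 0) (at_left 0)"
        using g_continuous by (meson UNIV_I continuous_on_def tendsto_within_subset subset_UNIV)
      ultimately show False using tendsto_unique trivial_limit_at_left_real by blast
    qed
    with nz g_supp[OF nz] have u: "0 < ?u" "?u < 1" by (metis order_le_less)+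
    have "real j + 1 \<le> real N2" using that by linarith
    moreover have "N2 = (b2 - y0) / H2" using N_pos y_less by (simp add: H2_def)
    ultimately have "0 < (snd z - y0) / H2" "(snd z - y0) / H2 < (b2 - y0) / H2"
      using u by linarith+
    with assms H_pos show False by (auto simp: divide_less_cancel zero_less_divide_iff)
  qed
  then show ?thesis unfolding pert_def by (auto intro!: sum.neutral)
qed

text \<open>The derivative in \<open>y\<close> is at least \<open>\<epsilon> - a * M / H2\<close>,
  which is nonnegative by \<open>slope\<close>.\<close>

lemma line_pert_mono:
  assumes "y \<le> y'"
  shows "\<epsilon> * y + pert S (x, y) \<le> \<epsilon> * y' + pert S (x, y')"
proof (rule DERIV_nonneg_imp_nondecreasing[OF assms], intro exI conjI)
  fix y
  let ?c = "\<lambda>j. wave 0 N1 (\<lambda>i. of_bool ((i, j) \<in> S)) ((x - a1) / H1)"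
  let ?d = "\<epsilon> + a * (wave (Suc 0) N2 ?c ((y - y0) / H2) / H2)"
  show "((\<lambda>y. \<epsilon> * y + pert S (x, y)) has_real_derivative ?d) (at y)"
    unfolding pert_wave2 using r_ge
    by (intro DERIV_add DERIV_cmult wave_deriv) (auto intro!: derivative_eq_intros)
  have "\<bar>wave (Suc 0) N2 ?c ((y - y0) / H2)\<bar> \<le> 1 * M"
    using r_ge by (intro wave_bound wave_of_bool g_bound) auto
  then have "- M \<le> wave (Suc 0) N2 ?c ((y - y0) / H2)" by linarith
  then have "- (M / H2) \<le> wave (Suc 0) N2 ?c ((y - y0) / H2) / H2"
    using divide_right_mono[of "- M" _ H2] H_pos by simp
  then have "a * - (M / H2) \<le> a * (wave (Suc 0) N2 ?c ((y - y0) / H2) / H2)"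
    by (intro mult_left_mono a_nonneg)
  moreover have "a * (M / H2) \<le> \<epsilon>" using slope by (simp add: H2_def)
  ultimately show "0 \<le> ?d" by simp
qed

text \<open>The jump to \<open>1\<close> is placed at \<open>b2 + 1\<close>, strictly above the
  observation window, so the total mass is reached without disturbing the values on it;
  \<open>max 0\<close> keeps mass off the negative axis.\<close>

definition hyp :: "(nat \<times> nat) set \<Rightarrow> real \<times> real \<Rightarrow> real" where
  "hyp S z = (if snd z < b2 + 1 then \<epsilon> * max 0 (snd z) + pert S z else 1)"

lemma hyp_measurable [measurable]: "hyp S \<in> borel_measurable borel"
proof -
  have "hyp S \<in> borel_measurable (borel \<Otimes>\<^sub>M borel)" unfolding hyp_def by measurable
  then show ?thesis by (simp only: borel_prod)
qed

lemma hyp_lt: "y < b2 + 1 \<Longrightarrow> hyp S (x, y) = \<epsilon> * max 0 y + pert S (x, y)"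
  by (simp add: hyp_def)

text \<open>By monotonicity the largest value is at \<open>b2 + 1\<close>, where the perturbation is
  zero. The bound makes the final jump go upwards, and it keeps \<open>1 - hyp S z\<close> at least
  \<open>1/2\<close> on the cells in the chi-square estimate.\<close>

lemma line_le_half:
  assumes "y \<le> b2 + 1" shows "\<epsilon> * max 0 y + pert S (x, y) \<le> 1/2"
proof -
  have "\<epsilon> * max 0 y + pert S (x, y) \<le> \<epsilon> * (b2 + 1) + pert S (x, b2 + 1)"
    using line_pert_mono[of "max 0 y" "b2 + 1" S x] assms y0_pos y_less pert_zero[of "(x, y)" S]
      pert_zero[of "(x, 0)" S] by (auto simp: max_def split: if_splits)
  also have "pert S (x, b2 + 1) = 0" by (rule pert_zero) simp
  finally show ?thesis using \<epsilon>_le by simp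
qed

lemma hyp_mono: "y \<le> y' \<Longrightarrow> hyp S (x, y) \<le> hyp S (x, y')"
proof -
  assume le: "y \<le> y'"
  have "\<epsilon> * max 0 y + pert S (x, y) \<le> \<epsilon> * max 0 y' + pert S (x, y')"
  proof (cases "0 \<le> y")
    case True then show ?thesis using line_pert_mono[OF le] le by (simp add: max_def)
  next
    case False
    then have "pert S (x, y) = 0" using y0_pos by (intro pert_zero) auto
    then show ?thesis using False pert_nonneg[of S] \<epsilon>_pos by auto
  qed
  moreover have "\<epsilon> * max 0 y + pert S (x, y) \<le> 1" if "y < b2 + 1"
    using line_le_half[of y S x] that by simp
  ultimately show ?thesis using le by (auto simp: hyp_def)
qed

lemma hyp_right_cont: "continuous (at_right y) (\<lambda>y. hyp S (x, y))"
proof -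
  have c: "continuous_on UNIV (\<lambda>y. \<epsilon> * max 0 y + pert S (x, y))"
    unfolding pert_def fst_conv snd_conv using H_pos
    by (auto intro!: continuous_intros continuous_on_compose2[OF g_continuous])
  show ?thesis
  proof (cases "y < b2 + 1")
    case True
    have "((\<lambda>y. \<epsilon> * max 0 y + pert S (x, y)) \<longlongrightarrow> \<epsilon> * max 0 y + pert S (x, y)) (at_right y)"
      using c by (meson UNIV_I continuous_on_def tendsto_within_subset subset_UNIV)
    moreover have "\<forall>\<^sub>F y' in at_right y. \<epsilon> * max 0 y' + pert S (x, y') = hyp S (x, y')"
      unfolding eventually_at_right_field using True by (auto simp: hyp_def intro!: exI[of _ "b2 + 1"])
    ultimately show ?thesis
      unfolding continuous_within using True by (simp add: hyp_lt tendsto_cong)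
  next
    case False
    then have "\<forall>\<^sub>F y' in at_right y. hyp S (x, y') = hyp S (x, y)"
      unfolding eventually_at_right_field by (auto simp: hyp_def intro!: exI[of _ "y + 1"])
    then show ?thesis unfolding continuous_within by (rule tendsto_eventually)
  qed
qed

lemma hyp_nonpos: "y \<le> 0 \<Longrightarrow> hyp S (x, y) = 0"
  using pert_zero[of "(x, y)" S] y0_pos y_less by (simp add: hyp_def)

lemma hyp_bounds: "0 \<le> hyp S z" "hyp S z \<le> 1"
  using line_le_half[of "snd z" S "fst z"] pert_nonneg[of S z] \<epsilon>_pos by (auto simp: hyp_def)

lemma cond_cdf_hyp: "cond_cdf (hyp S)"
  unfolding cond_cdf_def
proof (intro conjI allI)
  show "hyp S \<in> borel_measurable lborel" by simp
  fix x
  let ?F = "\<lambda>y. hyp S (x, y)"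
  have bot: "(?F \<longlongrightarrow> 0) at_bot"
    by (rule tendsto_eventually, rule eventually_mono[OF eventually_le_at_bot[of 0]]) (simp add: hyp_nonpos)
  have top: "(?F \<longlongrightarrow> 1) at_top"
    by (rule tendsto_eventually, rule eventually_mono[OF eventually_ge_at_top[of "b2 + 1"]]) (simp add: hyp_def)
  have cdf: "cdf (interval_measure ?F) = ?F"
    by (intro cdf_interval_measure hyp_mono hyp_right_cont bot)
  have "measure (interval_measure ?F) {..0} = 0"
    using fun_cong[OF cdf, of 0] by (simp add: cdf_def hyp_nonpos)
  then show "\<exists>M. real_distribution M \<and> measure M {..0} = 0 \<and> (\<forall>y. hyp S (x, y) = cdf M y)"
    using cdf by (intro exI[of _ "interval_measure ?F"] conjI real_distribution_interval_measure
        hyp_mono hyp_right_cont bot top) auto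
qed

end

section \<open>Besov norms of the hypotheses\<close>

lemma L2norm_le:
  assumes S: "S \<subseteq> {a1..b1} \<times> {a2..b2}" and ab: "a1 \<le> b1" "a2 \<le> b2"
    and B: "\<And>z. z \<in> S \<Longrightarrow> \<bar>f z\<bar> \<le> B" and "0 \<le> B"
  shows "L2norm S f \<le> ennreal (B * sqrt ((b1 - a1) * (b2 - a2)))"
proof -
  let ?A = "{a1..b1} \<times> {a2..b2}"
  let ?I = "\<integral>\<^sup>+ z \<in> S. ennreal ((f z)\<^sup>2) \<partial>lborel"
  have "?I \<le> (\<integral>\<^sup>+ z. ennreal (B\<^sup>2) * indicator ?A z \<partial>lborel)"
  proof (rule nn_integral_mono)
    fix z
    show "ennreal ((f z)\<^sup>2) * indicator S z \<le> ennreal (B\<^sup>2) * indicator ?A z"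
    proof (cases "z \<in> S")
      case True
      then have "(f z)\<^sup>2 \<le> B\<^sup>2" using power_mono[OF B[OF True], of 2] by simp
      then show ?thesis using True S by (auto simp: ennreal_leI)
    qed simp
  qed
  also have "\<dots> = ennreal (B\<^sup>2) * emeasure (lborel \<Otimes>\<^sub>M lborel) ?A"
    by (subst nn_integral_cmult_indicator) (simp_all add: lborel_prod borel_prod[symmetric])
  also have "emeasure (lborel \<Otimes>\<^sub>M lborel) ?A = ennreal ((b1 - a1) * (b2 - a2))"
    using ab by (subst lborel.emeasure_pair_measure_Times) (simp_all add: ennreal_mult)
  finally have I: "?I \<le> ennreal (B\<^sup>2 * ((b1 - a1) * (b2 - a2)))"
    using ab by (simp add: ennreal_mult'')
  have "sqrt (enn2real ?I) \<le> sqrt (B\<^sup>2 * ((b1 - a1) * (b2 - a2)))"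
    using enn2real_leI[OF _ I] ab by simp
  also have "\<dots> = B * sqrt ((b1 - a1) * (b2 - a2))"
    using \<open>0 \<le> B\<close> by (simp add: real_sqrt_mult)
  finally have "sqrt (enn2real ?I) \<le> B * sqrt ((b1 - a1) * (b2 - a2))" .
  moreover have "?I \<noteq> \<infinity>" using I by (auto simp: top_unique)
  ultimately show ?thesis by (simp add: L2norm_def Let_def ennreal_leI)
qed

text \<open>The two bounds on \<open>x\<close> cross near
  \<open>t = \<sigma> powr (1/\<beta>)\<close>. Above it \<open>t powr (- \<beta>)\<close> is at
  most \<open>1 / \<sigma>\<close>, which cancels the height; below it the factor
  \<open>(t / H) ^ s\<close> compensates since \<open>s\<close> is at least \<beta>. The bound is
  uniform in \<open>t\<close> and \<sigma>.\<close>

lemma powr_scale_bound: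
  fixes t \<sigma> \<beta> \<gamma> H M x :: real and s :: nat
  assumes "0 < t" "0 < \<sigma>" "0 < \<beta>" "\<beta> \<le> s" "\<sigma> powr (1/\<beta>) / 2 \<le> H" "1 \<le> M" "0 \<le> \<gamma>"
    and x1: "x \<le> \<gamma> * \<sigma> * 2 ^ s" and x2: "x \<le> \<gamma> * \<sigma> * (M * (t / H) ^ s)"
  shows "t powr (- \<beta>) * x \<le> \<gamma> * (M * 2 ^ s)"
proof (cases "\<sigma> powr (1/\<beta>) \<le> t")
  case True
  have "t powr (- \<beta>) \<le> (\<sigma> powr (1/\<beta>)) powr (- \<beta>)"
    using True assms by (intro powr_mono2') auto
  also have "\<dots> = 1 / \<sigma>" using assms by (simp add: powr_powr powr_minus_divide)
  finally have "t powr (- \<beta>) * x \<le> 1 / \<sigma> * (\<gamma> * \<sigma> * 2 ^ s)"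
    using assms by (intro order_trans[OF mult_left_mono[OF x1]] mult_right_mono) auto
  also have "\<dots> = \<gamma> * (1 * 2 ^ s)" using assms by simp
  also have "\<dots> \<le> \<gamma> * (M * 2 ^ s)" using assms by (intro mult_left_mono mult_right_mono) auto
  finally show ?thesis .
next
  case False
  let ?h = "\<sigma> powr (1/\<beta>)"
  have h: "0 < ?h" "0 < H" using assms by (auto intro: less_le_trans[of 0 "?h / 2"])
  have "t / H \<le> 2 * (t / ?h)"
    using assms h mult_left_mono[of "?h / 2" H t] by (simp add: field_simps)
  then have "(t / H) ^ s \<le> (2 * (t / ?h)) ^ s" using assms h by (intro power_mono) auto
  also have "\<dots> = 2 ^ s * (t powr s * ?h powr (- s))"
    using assms h by (simp add: power_mult_distrib power_divide powr_realpow powr_minus_divide)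
  finally have "t powr (- \<beta>) * (t / H) ^ s \<le> t powr (- \<beta>) * (2 ^ s * (t powr s * ?h powr (- s)))"
    by (intro mult_left_mono) auto
  also have "\<dots> = 2 ^ s * (t powr (s - \<beta>) * ?h powr (- s))"
    using assms by (simp add: powr_diff powr_minus_divide)
  also have "\<dots> \<le> 2 ^ s * (?h powr (s - \<beta>) * ?h powr (- s))"
    using assms False by (intro mult_left_mono mult_right_mono powr_mono2) auto
  also have "?h powr (s - \<beta>) * ?h powr (- s) = ?h powr (- \<beta>)"
    by (simp only: powr_add[symmetric]) simp
  also have "\<dots> = 1 / \<sigma>" using assms by (simp add: powr_powr powr_minus_divide)
  finally have *: "t powr (- \<beta>) * (t / H) ^ s \<le> 2 ^ s * (1 / \<sigma>)" .
  have "t powr (- \<beta>) * x \<le> t powr (- \<beta>) * (\<gamma> * \<sigma> * (M * (t / H) ^ s))"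
    by (intro mult_left_mono x2) auto
  also have "\<dots> = \<gamma> * \<sigma> * M * (t powr (- \<beta>) * (t / H) ^ s)" by (simp add: mult_ac)
  also have "\<dots> \<le> \<gamma> * \<sigma> * M * (2 ^ s * (1 / \<sigma>))"
    using assms by (intro mult_left_mono *) auto
  also have "\<dots> = \<gamma> * (M * 2 ^ s)" using assms by simp
  finally show ?thesis .
qed

lemma modsmooth_le:
  assumes ab: "a1 \<le> b1" "a2 \<le> b2" and A: "A = {a1..b1} \<times> {a2..b2}" and "0 \<le> B"
    and B: "\<And>h x y. \<bar>h\<bar> \<le> t \<Longrightarrow> (x, y) \<in> shift_dom A s h j \<Longrightarrow> \<bar>fdiff s h j f (x, y)\<bar> \<le> B"
  shows "modsmooth A s j f t \<le> ennreal (B * sqrt ((b1 - a1) * (b2 - a2)))"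
  unfolding modsmooth_def using B ab \<open>0 \<le> B\<close>
  by (intro SUP_least L2norm_le) (auto simp: shift_dom_def A)

text \<open>\<open>shift_dom\<close> tests only the first and the last node of a difference; the
  intermediate nodes follow by convexity, for either sign of \<open>h\<close>.\<close>

lemma between_steps:
  fixes y h :: real
  assumes "y \<in> {c..d}" "y + real s * h \<in> {c..d}" "k \<le> s"
  shows "y + real k * h \<in> {c..d}"
proof (cases "0 \<le> h")
  case True
  then have "0 \<le> real k * h" "real k * h \<le> real s * h" using assms by (auto intro: mult_right_mono)
  then show ?thesis using assms by auto
next
  case False
  then have "real k * h \<le> 0" "real s * h \<le> real k * h"
    using assms by (auto intro: mult_right_mono_neg mult_nonneg_nonpos)
  then show ?thesis using assms by auto
qed

context perturbation
begin

lemma hyp_fdiff1: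
  assumes "1 \<le> s" "y \<le> b2"
  shows "fdiff s h 1 (hyp S) (x, y) = ndiff s h (\<lambda>x. pert S (x, y)) x"
proof -
  have "fdiff s h 1 (hyp S) (x, y) = ndiff s h (\<lambda>x. \<epsilon> * max 0 y + pert S (x, y)) x"
    unfolding fdiff_1 using assms by (simp add: hyp_lt)
  then show ?thesis using assms by (simp add: ndiff_add ndiff_const)
qed

text \<open>All nodes have their second coordinate in \<open>{a2..b2}\<close>, where the base is
  linear, so a difference of order at least 2 annihilates it.\<close>

lemma hyp_fdiff2:
  assumes "2 \<le> s" "0 \<le> a2" "(x, y) \<in> shift_dom ({a1..b1} \<times> {a2..b2}) s h 2"
  shows "fdiff s h 2 (hyp S) (x, y) = ndiff s h (\<lambda>y. pert S (x, y)) y"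
proof -
  have y: "y \<in> {a2..b2}" "y + real s * h \<in> {a2..b2}"
    using assms(3) by (auto simp: shift_dom_def evec_def)
  have "fdiff s h 2 (hyp S) (x, y) = ndiff s h (\<lambda>y. \<epsilon> * y + pert S (x, y)) y"
    unfolding fdiff_2
  proof (rule ndiff_cong)
    fix k assume "k \<le> s"
    from between_steps[OF y this] show "hyp S (x, y + real k * h) = \<epsilon> * (y + real k * h) + pert S (x, y + real k * h)"
      using assms by (simp add: hyp_lt max_def)
  qed
  then show ?thesis using assms by (simp add: ndiff_add ndiff_linear)
qed

text \<open>Each direction contributes at most \<open>\<gamma> * (M * 2 ^ r)\<close> and the sup
  norm on the rectangle is at most \<open>\<epsilon> * b2 + \<gamma>\<close>, all times the root of
  the area. None of this depends on \<sigma>, so small \<epsilon> and \<gamma> fit any radius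
  \<open>L\<close>.\<close>

lemma hyp_besov_ball:
  fixes a2 \<beta>1 \<beta>2 \<gamma> \<sigma> L :: real
  assumes a2: "0 \<le> a2" "a2 \<le> b2" and \<beta>: "0 < \<beta>1" "1 < \<beta>2"
    and r: "besov_order \<beta>1 \<le> r" "besov_order \<beta>2 \<le> r"
    and \<gamma>: "0 \<le> \<gamma>" and \<sigma>: "0 < \<sigma>" "\<sigma> \<le> 1" and a: "a = \<gamma> * \<sigma>"
    and H: "\<sigma> powr (1/\<beta>1) / 2 \<le> H1" "\<sigma> powr (1/\<beta>2) / 2 \<le> H2"
    and L: "(2 * (\<gamma> * (M * 2 ^ r)) + (\<epsilon> * b2 + \<gamma>)) * sqrt ((b1 - a1) * (b2 - a2)) \<le> L"
  shows "hyp S \<in> besov_ball ({a1..b1} \<times> {a2..b2}) \<beta>1 \<beta>2 L"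
proof -
  let ?A = "{a1..b1} \<times> {a2..b2}" and ?v = "sqrt ((b1 - a1) * (b2 - a2))"
  let ?s1 = "besov_order \<beta>1" and ?s2 = "besov_order \<beta>2"
  have s: "1 \<le> ?s1" "\<beta>1 \<le> ?s1" "2 \<le> ?s2" "\<beta>2 \<le> ?s2"
    using \<beta> by (auto simp: besov_order_def) linarith+
  have ab: "a1 \<le> b1" using x_less by simp
  have M2: "\<gamma> * (M * 2 ^ s) \<le> \<gamma> * (M * 2 ^ r)" if "s \<le> r" for s
    using that \<gamma> M_ge_1 by (intro mult_left_mono power_increasing) auto
  have dir: "ennreal (t powr (- \<beta>)) * modsmooth ?A s j (hyp S) t \<le> ennreal (\<gamma> * (M * 2 ^ r) * ?v)"
    if t: "0 < t" and b: "0 < \<beta>" "\<beta> \<le> real s" "s \<le> r" and HH: "\<sigma> powr (1/\<beta>) / 2 \<le> H" "0 < H"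
      and d1: "\<And>h x y. (x, y) \<in> shift_dom ?A s h j \<Longrightarrow> \<bar>fdiff s h j (hyp S) (x, y)\<bar> \<le> a * 2 ^ s"
      and d2: "\<And>h x y. (x, y) \<in> shift_dom ?A s h j \<Longrightarrow> \<bar>fdiff s h j (hyp S) (x, y)\<bar> \<le> a * (M * (\<bar>h\<bar> / H) ^ s)"
    for t \<beta> s j H
  proof -
    \<comment> \<open>The minimum keeps the crude and the smooth bound available at once, as
      \<open>powr_scale_bound\<close> requires.\<close>
    let ?B = "min (a * 2 ^ s) (a * (M * (t / H) ^ s))"
    have B0: "0 \<le> ?B" using a_nonneg M_ge_1 t HH by auto
    have "modsmooth ?A s j (hyp S) t \<le> ennreal (?B * ?v)"
    proof (rule modsmooth_le[OF ab a2(2) refl B0])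
      fix h x y assume h: "\<bar>h\<bar> \<le> t" and xy: "(x, y) \<in> shift_dom ?A s h j"
      have "a * (M * (\<bar>h\<bar> / H) ^ s) \<le> a * (M * (t / H) ^ s)"
        using h HH a_nonneg M_ge_1 by (intro mult_left_mono power_mono divide_right_mono) auto
      then show "\<bar>fdiff s h j (hyp S) (x, y)\<bar> \<le> ?B"
        using d1[OF xy] d2[OF xy] by simp
    qed
    then have "ennreal (t powr (- \<beta>)) * modsmooth ?A s j (hyp S) t
        \<le> ennreal (t powr (- \<beta>)) * ennreal (?B * ?v)" by (rule mult_left_mono) simp
    also have "\<dots> = ennreal (t powr (- \<beta>) * ?B * ?v)"
      by (simp add: ennreal_mult'[symmetric] mult.assoc)
    also have "\<dots> \<le> ennreal (\<gamma> * (M * 2 ^ r) * ?v)"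
    proof (intro ennreal_leI mult_right_mono)
      have "t powr (- \<beta>) * ?B \<le> \<gamma> * (M * 2 ^ s)"
        using powr_scale_bound[OF t \<sigma>(1) b(1,2) HH(1) M_ge_1 \<gamma>, of ?B] by (simp add: a)
      then show "t powr (- \<beta>) * ?B \<le> \<gamma> * (M * 2 ^ r)" using M2[OF b(3)] by simp
    qed (use ab a2 in auto)
    finally show ?thesis .
  qed
  have semi: "besov_seminorm ?A \<beta>1 \<beta>2 (hyp S) \<le> ennreal (2 * (\<gamma> * (M * 2 ^ r)) * ?v)"
    unfolding besov_seminorm_def
  proof (rule SUP_least)
    fix t :: real assume "t \<in> {0<..}"
    then have t: "0 < t" by simp
    have 1: "ennreal (t powr (- \<beta>1)) * modsmooth ?A ?s1 1 (hyp S) t \<le> ennreal (\<gamma> * (M * 2 ^ r) * ?v)"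
      using pert_ndiff1[OF r(1)] pert_ndiff_sup(1) s
      by (intro dir[where H=H1] t \<beta> s r H H_pos) (subst hyp_fdiff1; auto simp: shift_dom_def)+
    have 2: "ennreal (t powr (- \<beta>2)) * modsmooth ?A ?s2 2 (hyp S) t \<le> ennreal (\<gamma> * (M * 2 ^ r) * ?v)"
      using pert_ndiff2[OF r(2)] pert_ndiff_sup(2) s \<beta>
      by (intro dir[where H=H2] t s r H H_pos) (auto simp: hyp_fdiff2[OF _ a2(1)])
    have 0: "0 \<le> \<gamma> * (M * 2 ^ r) * ?v" using \<gamma> M_ge_1 ab a2 by auto
    have "2 * (\<gamma> * (M * 2 ^ r)) * ?v = \<gamma> * (M * 2 ^ r) * ?v + \<gamma> * (M * 2 ^ r) * ?v" by algebra
    then have "ennreal (2 * (\<gamma> * (M * 2 ^ r)) * ?v) = ennreal (\<gamma> * (M * 2 ^ r) * ?v) + ennreal (\<gamma> * (M * 2 ^ r) * ?v)"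
      by (simp only: ennreal_plus[OF 0 0])
    with add_mono[OF 1 2]
    show "ennreal (t powr - \<beta>1) * modsmooth ?A ?s1 1 (hyp S) t + ennreal (t powr - \<beta>2) * modsmooth ?A ?s2 2 (hyp S) t
      \<le> ennreal (2 * (\<gamma> * (M * 2 ^ r)) * ?v)" by simp
  qed
  have "\<bar>hyp S z\<bar> \<le> \<epsilon> * b2 + \<gamma>" if "z \<in> ?A" for z
  proof -
    have "snd z \<le> b2" "0 \<le> snd z" using that a2 by auto
    then have "\<epsilon> * max 0 (snd z) \<le> \<epsilon> * b2" using \<epsilon>_pos by (intro mult_left_mono) auto
    moreover have "pert S z \<le> \<gamma>" using pert_le[of S z] \<gamma> \<sigma> mult_left_mono[of \<sigma> 1 \<gamma>] by (simp add: a)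
    ultimately show ?thesis
      using hyp_bounds[of S z] \<open>snd z \<le> b2\<close> by (simp add: hyp_def)
  qed
  then have l2: "L2norm ?A (hyp S) \<le> ennreal ((\<epsilon> * b2 + \<gamma>) * ?v)"
    using \<epsilon>_pos a2 \<gamma> by (intro L2norm_le ab a2) auto
  have "besov_norm ?A \<beta>1 \<beta>2 (hyp S) \<le> ennreal (2 * (\<gamma> * (M * 2 ^ r)) * ?v) + ennreal ((\<epsilon> * b2 + \<gamma>) * ?v)"
    unfolding besov_norm_def by (intro add_mono semi l2)
  also have "\<dots> = ennreal ((2 * (\<gamma> * (M * 2 ^ r)) + (\<epsilon> * b2 + \<gamma>)) * ?v)"
    using \<epsilon>_pos a2 \<gamma> M_ge_1 ab by (subst ennreal_plus[symmetric]) (auto simp: distrib_right)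
  also have "\<dots> \<le> ennreal L" by (intro ennreal_leI L)
  finally show ?thesis by (simp add: besov_ball_def)
qed

end

section \<open>Two-point bounds and the Assouad lemma\<close>

text \<open>The likelihood ratio of an i.i.d. sample is a product. Both measures agree on
  rectangles, whose indicators factor over the coordinates, and this determines a finite product
  measure.\<close>

lemma PiM_density:
  assumes "finite I" and M: "prob_space M" and D: "prob_space (density M w)"
    and w [measurable]: "w \<in> borel_measurable M"
  shows "PiM I (\<lambda>_. density M w) = density (PiM I (\<lambda>_. M)) (\<lambda>\<omega>. \<Prod>i\<in>I. w (\<omega> i))"
proof -
  interpret M: prob_space M by fact
  interpret D: prob_space "density M w" by fact
  interpret P: product_sigma_finite "\<lambda>_. M" ..
  interpret Q: product_sigma_finite "\<lambda>_. density M w" ..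
  have "density (PiM I (\<lambda>_. M)) (\<lambda>\<omega>. \<Prod>i\<in>I. w (\<omega> i)) = PiM I (\<lambda>_. density M w)"
  proof (rule Q.PiM_eqI[OF \<open>finite I\<close>])
    show "sets (density (PiM I (\<lambda>_. M)) (\<lambda>\<omega>. \<Prod>i\<in>I. w (\<omega> i))) = sets (PiM I (\<lambda>_. density M w))"
      by (simp cong: sets_PiM_cong)
    fix A assume A: "\<And>i. i \<in> I \<Longrightarrow> A i \<in> sets (density M w)"
    then have [measurable]: "i \<in> I \<Longrightarrow> A i \<in> sets M" for i by simp
    have "emeasure (density (PiM I (\<lambda>_. M)) (\<lambda>\<omega>. \<Prod>i\<in>I. w (\<omega> i))) (Pi\<^sub>E I A)
        = (\<integral>\<^sup>+ \<omega>. (\<Prod>i\<in>I. w (\<omega> i)) * indicator (Pi\<^sub>E I A) \<omega> \<partial>PiM I (\<lambda>_. M))"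
      using \<open>finite I\<close> by (intro emeasure_density) (auto intro!: sets_PiM_I_finite)
    also have "\<dots> = (\<integral>\<^sup>+ \<omega>. (\<Prod>i\<in>I. w (\<omega> i) * indicator (A i) (\<omega> i)) \<partial>PiM I (\<lambda>_. M))"
    proof (rule nn_integral_cong)
      fix \<omega> assume "\<omega> \<in> space (PiM I (\<lambda>_. M))"
      then have "indicator (Pi\<^sub>E I A) \<omega> = (\<Prod>i\<in>I. indicator (A i) (\<omega> i) :: ennreal)"
        using \<open>finite I\<close> by (auto simp: space_PiM PiE_iff indicator_def prod_zero_iff split: if_splits)
      then show "(\<Prod>i\<in>I. w (\<omega> i)) * indicator (Pi\<^sub>E I A) \<omega> = (\<Prod>i\<in>I. w (\<omega> i) * indicator (A i) (\<omega> i))"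
        by (simp add: prod.distrib)
    qed
    also have "\<dots> = (\<Prod>i\<in>I. \<integral>\<^sup>+ x. w x * indicator (A i) x \<partial>M)"
      by (rule P.product_nn_integral_prod) (auto intro: \<open>finite I\<close>)
    also have "\<dots> = (\<Prod>i\<in>I. emeasure (density M w) (A i))"
      by (intro prod.cong refl) (simp add: emeasure_density)
    finally show "emeasure (density (PiM I (\<lambda>_. M)) (\<lambda>\<omega>. \<Prod>i\<in>I. w (\<omega> i))) (Pi\<^sub>E I A)
        = (\<Prod>i\<in>I. emeasure (density M w) (A i))" .
  qed
  then show ?thesis by simp
qed

text \<open>Le Cam's two-point argument with likelihood ratio \<open>W\<close>: the two errors add
  up to at least \<open>D\<close> times the affinity, the integral of \<open>min 1 W\<close>, and
  the second moment bound makes the affinity at least \<open>1/2\<close>.\<close>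

lemma nn_integral_sum_ge_affinity:
  assumes P: "prob_space P" and Q: "prob_space (density P W)"
    and [measurable]: "W \<in> borel_measurable P" "g1 \<in> borel_measurable P" "g2 \<in> borel_measurable P"
    and W2: "(\<integral>\<^sup>+ \<omega>. W \<omega> ^ 2 \<partial>P) \<le> 2"
    and D: "\<And>\<omega>. \<omega> \<in> space P \<Longrightarrow> ennreal D \<le> g1 \<omega> + g2 \<omega>"
  shows "ennreal (D / 2) \<le> (\<integral>\<^sup>+ \<omega>. g1 \<omega> \<partial>P) + (\<integral>\<^sup>+ \<omega>. g2 \<omega> \<partial>density P W)"
proof -
  let ?aff = "\<integral>\<^sup>+ \<omega>. min 1 (W \<omega>) \<partial>P"
  have "(\<integral>\<^sup>+ \<omega>. W \<omega> \<partial>P) = emeasure (density P W) (space P)"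
    by (subst emeasure_density) (auto intro!: nn_integral_cong)
  then have "1 = (\<integral>\<^sup>+ \<omega>. W \<omega> \<partial>P)"
    using prob_space.emeasure_space_1[OF Q] by simp
  \<comment> \<open>\<open>W \<le> 1 + W\<^sup>2/4\<close> is \<open>(W/2 - 1)\<^sup>2 \<ge> 0\<close>; this replaces the Cauchy-Schwarz bound on the total variation.\<close>
  also have "\<dots> \<le> (\<integral>\<^sup>+ \<omega>. min 1 (W \<omega>) + ennreal (1/4) * W \<omega> ^ 2 \<partial>P)"
  proof (rule nn_integral_mono)
    fix \<omega>
    show "W \<omega> \<le> min 1 (W \<omega>) + ennreal (1/4) * W \<omega> ^ 2"
    proof (cases "W \<omega>")
      case (real x)
      have "x \<le> 1 + 1/4 * x\<^sup>2" using zero_le_power2[of "x/2 - 1"] by (simp add: power2_eq_square field_simps)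
      then have "x \<le> min 1 x + 1/4 * x\<^sup>2" by (simp add: min_def)
      then have "ennreal x \<le> ennreal (min 1 x + 1/4 * x\<^sup>2)" by (rule ennreal_leI)
      also have "\<dots> = min 1 (ennreal x) + ennreal (1/4) * ennreal x ^ 2"
      proof -
        have "ennreal (min 1 x) = min 1 (ennreal x)" using real(1) by (simp add: min_def)
        moreover have "ennreal (1/4 * x\<^sup>2) = ennreal (1/4) * ennreal x ^ 2"
          using real(1) by (subst ennreal_mult) (simp_all add: ennreal_power)
        ultimately show ?thesis
          using real(1) by (subst ennreal_plus) simp_all
      qed
      finally show ?thesis using real by simp
    next
      case top
      have "ennreal (1/4) * (top * top) = top"
        by (simp add: ennreal_mult_eq_top_iff)
      then show ?thesis using top by (simp add: power2_eq_square)
    qed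
  qed
  also have "\<dots> = ?aff + ennreal (1/4) * (\<integral>\<^sup>+ \<omega>. W \<omega> ^ 2 \<partial>P)"
    by (subst nn_integral_add) (auto simp: nn_integral_cmult)
  also have "\<dots> \<le> ?aff + ennreal (1/4) * 2"
    by (intro add_left_mono mult_left_mono W2) auto
  also have "ennreal (1/4) * 2 = ennreal (1/2)"
    by (simp flip: ennreal_numeral ennreal_mult)
  finally have "ennreal (1/2) + ennreal (1/2) \<le> ?aff + ennreal (1/2)"
    by (metis ennreal_1 ennreal_plus field_sum_of_halves divide_nonneg_nonneg zero_le_numeral zero_le_one)
  then have aff: "ennreal (1/2) \<le> ?aff" by (simp add: add.commute ennreal_add_left_cancel_le)
  have "ennreal (D / 2) = ennreal (D * (1/2))" by simp
  also have "\<dots> = ennreal D * ennreal (1/2)" by (rule ennreal_mult'') simp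
  also have "\<dots> \<le> ennreal D * ?aff" by (intro mult_left_mono aff) simp
  also have "\<dots> = (\<integral>\<^sup>+ \<omega>. ennreal D * min 1 (W \<omega>) \<partial>P)" by (simp add: nn_integral_cmult)
  also have "\<dots> \<le> (\<integral>\<^sup>+ \<omega>. g1 \<omega> + W \<omega> * g2 \<omega> \<partial>P)"
  proof (rule nn_integral_mono)
    fix \<omega> assume "\<omega> \<in> space P"
    then have "ennreal D * min 1 (W \<omega>) \<le> (g1 \<omega> + g2 \<omega>) * min 1 (W \<omega>)"
      by (intro mult_right_mono D) auto
    also have "\<dots> \<le> g1 \<omega> * 1 + g2 \<omega> * W \<omega>"
      unfolding distrib_right by (intro add_mono mult_left_mono) auto
    finally show "ennreal D * min 1 (W \<omega>) \<le> g1 \<omega> + W \<omega> * g2 \<omega>" by (simp add: mult.commute)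
  qed
  also have "\<dots> = (\<integral>\<^sup>+ \<omega>. g1 \<omega> \<partial>P) + (\<integral>\<^sup>+ \<omega>. g2 \<omega> \<partial>density P W)"
    by (simp add: nn_integral_add nn_integral_density)
  finally show ?thesis .
qed

text \<open>Second moments of likelihood ratios multiply over independent observations, so the
  sample ratio has second moment at most \<open>(1 + \<kappa>) ^ n\<close>, hence at most
  \<open>exp (n * \<kappa>)\<close>, which is below \<open>2\<close> by the budget on
  \<kappa>.\<close>

lemma product_two_point_bound:
  fixes n :: nat
  assumes M: "prob_space M" and D: "prob_space (density M w)"
    and w [measurable]: "w \<in> borel_measurable M"
    and chi: "(\<integral>\<^sup>+ x. w x ^ 2 \<partial>M) \<le> ennreal (1 + \<kappa>)" and \<kappa>: "0 \<le> \<kappa>" "real n * \<kappa> \<le> 1/2"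
    and [measurable]: "g1 \<in> borel_measurable (PiM {..<n} (\<lambda>_. M))" "g2 \<in> borel_measurable (PiM {..<n} (\<lambda>_. M))"
    and g: "\<And>\<omega>. ennreal d \<le> g1 \<omega> + g2 \<omega>"
  shows "ennreal (d / 2) \<le> (\<integral>\<^sup>+ \<omega>. g1 \<omega> \<partial>PiM {..<n} (\<lambda>_. M)) + (\<integral>\<^sup>+ \<omega>. g2 \<omega> \<partial>PiM {..<n} (\<lambda>_. density M w))"
proof -
  interpret M: prob_space M by fact
  interpret D: prob_space "density M w" by fact
  interpret P: product_sigma_finite "\<lambda>_. M" ..
  interpret PP: product_prob_space "\<lambda>_. M" "{..<n}" ..
  interpret QQ: product_prob_space "\<lambda>_. density M w" "{..<n}" ..
  let ?W = "\<lambda>\<omega>. \<Prod>i<n. w (\<omega> i)"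
  have eq: "PiM {..<n} (\<lambda>_. density M w) = density (PiM {..<n} (\<lambda>_. M)) ?W"
    by (rule PiM_density[OF _ M D w]) simp
  have "(\<integral>\<^sup>+ \<omega>. ?W \<omega> ^ 2 \<partial>PiM {..<n} (\<lambda>_. M)) = (\<integral>\<^sup>+ \<omega>. (\<Prod>i<n. w (\<omega> i) ^ 2) \<partial>PiM {..<n} (\<lambda>_. M))"
    by (simp add: prod_power_distrib)
  also have "\<dots> = (\<integral>\<^sup>+ x. w x ^ 2 \<partial>M) ^ n"
    by (subst P.product_nn_integral_prod) auto
  also have "\<dots> \<le> ennreal (1 + \<kappa>) ^ n" by (intro power_mono chi) simp
  also have "\<dots> = ennreal ((1 + \<kappa>) ^ n)" using \<kappa> by (simp add: ennreal_power del: ennreal_plus)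
  also have "\<dots> \<le> ennreal 2"
  proof (rule ennreal_leI)
    have "(1 + \<kappa>) ^ n \<le> exp \<kappa> ^ n" using \<kappa> by (intro power_mono exp_ge_add_one_self) simp
    also have "\<dots> = exp (real n * \<kappa>)" by (simp add: exp_of_nat_mult)
    also have "\<dots> \<le> exp (1/2)" using \<kappa> by simp
    also have "\<dots> \<le> 2" using exp_half_le2 by simp
    finally show "(1 + \<kappa>) ^ n \<le> 2" .
  qed
  finally have "(\<integral>\<^sup>+ \<omega>. ?W \<omega> ^ 2 \<partial>PiM {..<n} (\<lambda>_. M)) \<le> 2" by simp
  then show ?thesis
    unfolding eq by (intro nn_integral_sum_ge_affinity g)
      (auto intro: PP.prob_space_axioms simp flip: eq intro!: QQ.prob_space_axioms)
qed

text \<open>The combinatorial half of Assouad's method: averaging over all vertices \<open>S\<close>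
  pairs each \<open>S\<close> without \<open>k\<close> with \<open>insert k S\<close>, so every
  coordinate costs at least \<open>\<delta> / 2\<close> on average.\<close>

lemma assouad:
  fixes r :: "'k \<Rightarrow> 'k set \<Rightarrow> ennreal"
  assumes K: "finite K"
    and pair: "\<And>k S. k \<in> K \<Longrightarrow> S \<subseteq> K - {k} \<Longrightarrow> \<delta> \<le> r k S + r k (insert k S)"
    and R: "\<And>S. S \<subseteq> K \<Longrightarrow> (\<Sum>k\<in>K. r k S) \<le> R"
  shows "of_nat (card K) * \<delta> \<le> 2 * R"
proof -
  let ?p = "of_nat (2 ^ card K) :: ennreal"
  \<comment> \<open>Written with the factor 2 on the right, from
    \<open>2 ^ card K = 2 * 2 ^ card (K - {k})\<close>, to avoid dividing in
    \<open>ennreal\<close>.\<close>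
  have half: "?p * \<delta> \<le> 2 * (\<Sum>S\<in>Pow K. r k S)" if k: "k \<in> K" for k
  proof -
    let ?K = "K - {k}"
    have K': "insert k ?K = K" using k by auto
    have inj: "inj_on (insert k) (Pow ?K)" by (auto simp: inj_on_def)
    have "card K = Suc (card ?K)" using K k by (metis card_Suc_Diff1)
    then have "?p * \<delta> = 2 * (\<Sum>S\<in>Pow ?K. \<delta>)"
      using K by (simp add: card_Pow mult.assoc)
    also have "\<dots> \<le> 2 * (\<Sum>S\<in>Pow ?K. r k S + r k (insert k S))"
      by (intro mult_left_mono sum_mono pair k) auto
    also have "(\<Sum>S\<in>Pow ?K. r k S + r k (insert k S)) = (\<Sum>S\<in>Pow ?K. r k S) + (\<Sum>S\<in>insert k ` Pow ?K. r k S)"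
      by (simp add: sum.distrib sum.reindex[OF inj])
    also have "\<dots> = (\<Sum>S\<in>Pow ?K \<union> insert k ` Pow ?K. r k S)"
      using K by (subst sum.union_disjoint) auto
    also have "Pow ?K \<union> insert k ` Pow ?K = Pow K" by (subst Pow_insert[symmetric]) (simp only: K')
    finally show ?thesis .
  qed
  have "?p * (of_nat (card K) * \<delta>) = (\<Sum>k\<in>K. ?p * \<delta>)" by (simp add: mult_ac)
  also have "\<dots> \<le> (\<Sum>k\<in>K. 2 * (\<Sum>S\<in>Pow K. r k S))" by (intro sum_mono half)
  also have "\<dots> = 2 * (\<Sum>S\<in>Pow K. \<Sum>k\<in>K. r k S)"
    by (simp add: sum_distrib_left[symmetric] sum.swap[of _ K])
  also have "\<dots> \<le> 2 * (\<Sum>S\<in>Pow K. R)" by (intro mult_left_mono sum_mono R) auto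
  also have "\<dots> = ?p * (2 * R)" using K by (simp add: card_Pow mult_ac)
  finally show ?thesis
    by (subst (asm) ennreal_mult_le_mult_iff) (auto simp: ennreal_of_nat_eq_real_of_nat)
qed

section \<open>The law of the observations\<close>

lemma nn_integral_obs_space:
  assumes "g \<in> borel_measurable obs_space"
  shows "(\<integral>\<^sup>+ x. g x \<partial>obs_space) = (\<integral>\<^sup>+ z. g (z, True) + g (z, False) \<partial>lborel)"
proof -
  interpret B: sigma_finite_measure "count_space (UNIV :: bool set)"
    by (rule sigma_finite_measure_count_space_finite) simp
  show ?thesis
    using B.nn_integral_fst[of g lborel] assms unfolding obs_space_def
    by (simp add: nn_integral_count_space_finite UNIV_bool add.commute)
qed

lemma measurable_obs_space_if [measurable]:
  assumes [measurable]: "u \<in> borel_measurable borel" "v \<in> borel_measurable borel"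
  shows "(\<lambda>(z, d). if d then u z else v z) \<in> borel_measurable obs_space"
  unfolding obs_space_def by measurable

lemma obs_law_eq:
  "obs_law f F = density obs_space (\<lambda>(z, d). if d then ennreal (f z * F z) else ennreal (f z * (1 - F z)))"
  unfolding obs_law_def by (intro arg_cong2[where f=density] refl) auto

lemma sets_obs_law [simp, measurable_cong]: "sets (obs_law f F) = sets obs_space"
  by (simp add: obs_law_def)

lemma space_obs_law [simp]: "space (obs_law f F) = space obs_space"
  by (simp add: obs_law_def)

lemma nn_integral_obs_law:
  assumes [measurable]: "f \<in> borel_measurable borel" "F \<in> borel_measurable borel" "g \<in> borel_measurable obs_space"
  shows "(\<integral>\<^sup>+ x. g x \<partial>obs_law f F)
    = (\<integral>\<^sup>+ z. ennreal (f z * F z) * g (z, True) + ennreal (f z * (1 - F z)) * g (z, False) \<partial>lborel)"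
  unfolding obs_law_eq by (subst nn_integral_density) (simp_all add: nn_integral_obs_space)

lemma prob_space_obs_law:
  assumes f: "design_density f" and F [measurable]: "F \<in> borel_measurable borel"
    and F01: "\<And>z. 0 \<le> F z" "\<And>z. F z \<le> 1"
  shows "prob_space (obs_law f F)"
proof
  have [measurable]: "f \<in> borel_measurable borel" using f by (simp add: design_density_def)
  have f0: "0 \<le> f z" for z using f unfolding design_density_def by blast
  have "emeasure (obs_law f F) (space (obs_law f F)) = (\<integral>\<^sup>+ x. 1 \<partial>obs_law f F)"
    by simp
  also have "\<dots> = (\<integral>\<^sup>+ z. ennreal (f z) \<partial>lborel)"
  proof (subst nn_integral_obs_law, simp_all, rule nn_integral_cong)
    fix z
    have "ennreal (f z * F z) + ennreal (f z * (1 - F z)) = ennreal (f z * F z + f z * (1 - F z))"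
      using f0 F01 by (intro ennreal_plus[symmetric]) auto
    then show "ennreal (f z * F z) + ennreal (f z * (1 - F z)) = ennreal (f z)"
      by (simp add: algebra_simps)
  qed
  finally show "emeasure (obs_law f F) (space (obs_law f F)) = 1"
    using f by (simp add: design_density_def)
qed

text \<open>The Radon-Nikodym derivative of \<open>obs_law f F'\<close> with respect to
  \<open>obs_law f F\<close>; the common design density cancels.\<close>

definition lik_ratio :: "(real \<times> real \<Rightarrow> real) \<Rightarrow> (real \<times> real \<Rightarrow> real) \<Rightarrow> (real \<times> real) \<times> bool \<Rightarrow> ennreal" where
  "lik_ratio F F' = (\<lambda>(z, d). if d then ennreal (F' z / F z) else ennreal ((1 - F' z) / (1 - F z)))"

lemma lik_ratio_measurable [measurable]:
  assumes [measurable]: "F \<in> borel_measurable borel" "F' \<in> borel_measurable borel"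
  shows "lik_ratio F F' \<in> borel_measurable obs_space"
  unfolding lik_ratio_def by measurable

text \<open>The conditions \<open>ac\<close> express absolute continuity: where a denominator is
  zero the quotient is \<open>0\<close> by convention, and the corresponding weight under
  \<open>F'\<close> is zero too.\<close>

lemma obs_law_density:
  assumes [measurable]: "f \<in> borel_measurable borel" "F \<in> borel_measurable borel" "F' \<in> borel_measurable borel"
    and F01: "\<And>z. 0 \<le> f z" "\<And>z. 0 \<le> F z" "\<And>z. F z \<le> 1" "\<And>z. 0 \<le> F' z" "\<And>z. F' z \<le> 1"
    and ac: "\<And>z. F z = 0 \<Longrightarrow> F' z = 0" "\<And>z. F z = 1 \<Longrightarrow> F' z = 1"
  shows "obs_law f F' = density (obs_law f F) (lik_ratio F F')"
proof -
  have "ennreal (f z * F z) * ennreal (F' z / F z) = ennreal (f z * F' z)" for z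
    using F01 ac(1)[of z] by (subst ennreal_mult'[symmetric]) auto
  moreover have "ennreal (f z * (1 - F z)) * ennreal ((1 - F' z) / (1 - F z)) = ennreal (f z * (1 - F' z))" for z
    using F01[of z] ac(2)[of z] by (subst ennreal_mult'[symmetric]) auto
  ultimately show ?thesis
    unfolding obs_law_eq lik_ratio_def
    by (subst density_density_eq) (auto intro!: arg_cong2[where f=density])
qed

text \<open>The last fraction is the chi-square divergence between the Bernoulli laws with
  parameters \<open>p'\<close> and \<open>p\<close>.\<close>

lemma chi_square_bernoulli:
  fixes p p' :: real
  assumes "0 < p" "p < 1"
  shows "p * (p' / p)\<^sup>2 + (1 - p) * ((1 - p') / (1 - p))\<^sup>2 = 1 + (p' - p)\<^sup>2 / (p * (1 - p))"
proof -
  define s where "s = 1 - p"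
  have ps: "p \<noteq> 0" "s \<noteq> 0" "p + s = 1" using assms by (auto simp: s_def)
  have "p * (p' / p)\<^sup>2 = p'\<^sup>2 / p" "s * ((1 - p') / s)\<^sup>2 = (1 - p')\<^sup>2 / s"
    using ps by (auto simp: power2_eq_square)
  moreover have "p'\<^sup>2 / p + (1 - p')\<^sup>2 / s = (p'\<^sup>2 * s + (1 - p')\<^sup>2 * p) / (p * s)"
    using ps by (simp add: add_frac_eq mult.commute)
  moreover have "p'\<^sup>2 * s + (1 - p')\<^sup>2 * p = p * s + (p' - p)\<^sup>2"
    unfolding s_def by (simp add: power2_eq_square algebra_simps)
  ultimately show ?thesis
    using ps by (simp add: s_def[symmetric] add_divide_distrib)
qed

text \<open>Given the design point, the second moment exceeds 1 only on \<open>C\<close>, by at most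
  \<open>q\<close>; integrating against \<open>f\<close>, which is almost everywhere at most
  \<open>h\<close>, gives the excess \<open>h * q * v\<close>.\<close>

lemma chi_square_obs_law:
  assumes f: "design_density f"
    and [measurable]: "F \<in> borel_measurable borel" "F' \<in> borel_measurable borel" "C \<in> sets borel"
    and F01: "\<And>z. 0 \<le> F z" "\<And>z. F z \<le> 1" "\<And>z. 0 \<le> F' z" "\<And>z. F' z \<le> 1"
    and out: "\<And>z. z \<notin> C \<Longrightarrow> F' z = F z"
    and inn: "\<And>z. z \<in> C \<Longrightarrow> 0 < F z \<and> F z < 1 \<and> (F' z - F z)\<^sup>2 \<le> q * (F z * (1 - F z))"
    and h: "AE z in lborel. f z \<le> h" "0 \<le> h" and "0 \<le> q" and C: "emeasure lborel C = ennreal v" "0 \<le> v"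
  shows "(\<integral>\<^sup>+ x. lik_ratio F F' x ^ 2 \<partial>obs_law f F) \<le> ennreal (1 + h * q * v)"
proof -
  have [measurable]: "f \<in> borel_measurable borel" using f by (simp add: design_density_def)
  have f0: "0 \<le> f z" for z using f unfolding design_density_def by blast
  have pt: "F z * (F' z / F z)\<^sup>2 + (1 - F z) * ((1 - F' z) / (1 - F z))\<^sup>2 \<le> 1 + q * indicator C z" for z
  proof (cases "z \<in> C")
    case True
    note i = inn[OF True]
    have "F z * (F' z / F z)\<^sup>2 + (1 - F z) * ((1 - F' z) / (1 - F z))\<^sup>2 = 1 + (F' z - F z)\<^sup>2 / (F z * (1 - F z))"
      using i by (simp add: chi_square_bernoulli)
    also have "(F' z - F z)\<^sup>2 / (F z * (1 - F z)) \<le> q"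
      using i by (simp add: divide_le_eq)
    finally show ?thesis using True by simp
  next
    case False
    \<comment> \<open>If \<open>F z\<close> is \<open>0\<close> or \<open>1\<close>, the term with
      zero denominator carries zero weight and the other equals 1.\<close>
    then show ?thesis using out[OF False] by (cases "F z = 0"; cases "F z = 1") (auto simp: power2_eq_square)
  qed
  have "(\<integral>\<^sup>+ x. lik_ratio F F' x ^ 2 \<partial>obs_law f F)
    = (\<integral>\<^sup>+ z. ennreal (f z * F z) * ennreal (F' z / F z) ^ 2
        + ennreal (f z * (1 - F z)) * ennreal ((1 - F' z) / (1 - F z)) ^ 2 \<partial>lborel)"
    by (subst nn_integral_obs_law) (simp_all add: lik_ratio_def)
  also have "\<dots> = (\<integral>\<^sup>+ z. ennreal (f z * (F z * (F' z / F z)\<^sup>2 + (1 - F z) * ((1 - F' z) / (1 - F z))\<^sup>2)) \<partial>lborel)"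
  proof (rule nn_integral_cong)
    fix z
    have nn: "0 \<le> F' z / F z" "0 \<le> (1 - F' z) / (1 - F z)" using F01[of z] by auto
    show "ennreal (f z * F z) * ennreal (F' z / F z) ^ 2 + ennreal (f z * (1 - F z)) * ennreal ((1 - F' z) / (1 - F z)) ^ 2
      = ennreal (f z * (F z * (F' z / F z)\<^sup>2 + (1 - F z) * ((1 - F' z) / (1 - F z))\<^sup>2))"
      unfolding ennreal_power[OF nn(1)] ennreal_power[OF nn(2)] distrib_left mult.assoc[symmetric]
      using f0[of z] F01[of z] by (subst ennreal_plus) (simp_all add: ennreal_mult'')
  qed
  also have "\<dots> \<le> (\<integral>\<^sup>+ z. ennreal (f z) + ennreal (h * q) * indicator C z \<partial>lborel)"
  proof (rule nn_integral_mono_AE, use h(1) in eventually_elim)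
    fix z assume fh: "f z \<le> h"
    have "f z * (F z * (F' z / F z)\<^sup>2 + (1 - F z) * ((1 - F' z) / (1 - F z))\<^sup>2) \<le> f z * (1 + q * indicator C z)"
      by (intro mult_left_mono pt f0)
    also have "\<dots> \<le> f z + h * q * indicator C z"
      using fh \<open>0 \<le> q\<close> by (simp add: distrib_left indicator_def mult_right_mono)
    finally have "ennreal (f z * (F z * (F' z / F z)\<^sup>2 + (1 - F z) * ((1 - F' z) / (1 - F z))\<^sup>2))
      \<le> ennreal (f z + h * q * indicator C z)" by (rule ennreal_leI)
    also have "\<dots> = ennreal (f z) + ennreal (h * q) * indicator C z"
      using f0 h \<open>0 \<le> q\<close> by (subst ennreal_plus) (auto simp: indicator_def)
    finally show "ennreal (f z * (F z * (F' z / F z)\<^sup>2 + (1 - F z) * ((1 - F' z) / (1 - F z))\<^sup>2))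
      \<le> ennreal (f z) + ennreal (h * q) * indicator C z" .
  qed
  also have "\<dots> = 1 + ennreal (h * q) * ennreal v"
    using f C by (subst nn_integral_add) (auto simp: design_density_def nn_integral_cmult_indicator)
  also have "\<dots> = ennreal (1 + h * q * v)"
    using h \<open>0 \<le> q\<close> \<open>0 \<le> v\<close> by (simp add: ennreal_mult)
  finally show ?thesis .
qed

lemma sets_sample_law [simp, measurable_cong]: "sets (sample_law n f F) = sets (\<Pi>\<^sub>M i\<in>{..<n}. obs_space)"
  unfolding sample_law_def by (intro sets_PiM_cong) auto

lemma estimator_error_measurable:
  assumes G: "G \<in> estimators n" and [measurable]: "F \<in> borel_measurable borel" "B \<in> sets borel"
  shows "(\<lambda>\<omega>. \<integral>\<^sup>+ z \<in> B. ennreal ((G \<omega> z - F z)\<^sup>2) \<partial>lborel) \<in> borel_measurable (\<Pi>\<^sub>M i\<in>{..<n}. obs_space)"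
proof -
  have [measurable]: "(\<lambda>(\<omega>, z). G \<omega> z) \<in> borel_measurable ((\<Pi>\<^sub>M i\<in>{..<n}. obs_space) \<Otimes>\<^sub>M lborel)"
    using G by (simp add: estimators_def)
  show ?thesis by measurable
qed

lemma estimator_section_measurable:
  assumes G: "G \<in> estimators n" and "\<omega> \<in> space (\<Pi>\<^sub>M i\<in>{..<n}. obs_space)"
  shows "G \<omega> \<in> borel_measurable lborel"
  using measurable_Pair2[of "\<lambda>(\<omega>, z). G \<omega> z" _ lborel borel \<omega>] G assms(2) by (simp add: estimators_def)

text \<open>Pointwise \<open>(F' - F)^2\<close> is at most twice the sum of the two squared errors:
  no \<open>G\<close> is close to both functions where they are \<open>d\<close> apart.\<close>

lemma integrated_error_sum_ge:
  assumes [measurable]: "G \<in> borel_measurable borel" "F \<in> borel_measurable borel" "F' \<in> borel_measurable borel" "B \<in> sets borel"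
    and B: "emeasure lborel B = ennreal v" and d: "0 \<le> d" "\<And>z. z \<in> B \<Longrightarrow> d \<le> \<bar>F' z - F z\<bar>"
  shows "ennreal (d\<^sup>2 / 2 * v) \<le> (\<integral>\<^sup>+ z \<in> B. ennreal ((G z - F z)\<^sup>2) \<partial>lborel) + (\<integral>\<^sup>+ z \<in> B. ennreal ((G z - F' z)\<^sup>2) \<partial>lborel)"
proof -
  have "ennreal (d\<^sup>2 / 2 * v) = (\<integral>\<^sup>+ z. ennreal (d\<^sup>2 / 2) * indicator B z \<partial>lborel)"
    using B ennreal_mult'[of "d\<^sup>2 / 2" v] by (simp add: nn_integral_cmult_indicator)
  also have "\<dots> \<le> (\<integral>\<^sup>+ z. ennreal ((G z - F z)\<^sup>2) * indicator B z + ennreal ((G z - F' z)\<^sup>2) * indicator B z \<partial>lborel)"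
  proof (rule nn_integral_mono)
    fix z
    have "d\<^sup>2 / 2 \<le> (G z - F z)\<^sup>2 + (G z - F' z)\<^sup>2" if "z \<in> B"
    proof -
      have "d\<^sup>2 \<le> (F' z - F z)\<^sup>2" using power_mono[OF d(2)[OF that] d(1), of 2] by simp
      also have "\<dots> \<le> 2 * ((G z - F z)\<^sup>2 + (G z - F' z)\<^sup>2)"
        using zero_le_power2[of "(G z - F z) + (G z - F' z)"] by (simp add: power2_eq_square algebra_simps)
      finally show ?thesis by simp
    qed
    then show "ennreal (d\<^sup>2 / 2) * indicator B z \<le> ennreal ((G z - F z)\<^sup>2) * indicator B z + ennreal ((G z - F' z)\<^sup>2) * indicator B z"
      by (auto simp: indicator_def ennreal_leI simp flip: ennreal_plus)
  qed
  also have "\<dots> = (\<integral>\<^sup>+ z \<in> B. ennreal ((G z - F z)\<^sup>2) \<partial>lborel) + (\<integral>\<^sup>+ z \<in> B. ennreal ((G z - F' z)\<^sup>2) \<partial>lborel)"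
    by (rule nn_integral_add) auto
  finally show ?thesis .
qed

section \<open>The minimax lower bound\<close>

lemma emeasure_rectangle:
  fixes a b c d :: real
  assumes "a \<le> b" "c \<le> d"
  shows "emeasure lborel ({a..b} \<times> {c..d}) = ennreal ((b - a) * (d - c))"
  using assms by (subst lborel_prod[symmetric], subst lborel.emeasure_pair_measure_Times)
    (simp_all add: ennreal_mult)

section \<open>Geometry of the grid: supports and cores of the bumps\<close>

context perturbation
begin

definition cell :: "nat \<times> nat \<Rightarrow> (real \<times> real) set" where
  "cell = (\<lambda>(i, j). {a1 + real i * H1..a1 + (real i + 1) * H1} \<times> {y0 + real j * H2..y0 + (real j + 1) * H2})"

text \<open>The middle half of a cell in each direction, hence a quarter of its area. There the bump
  is at least \<open>a * m0^2\<close>, and the cores are pairwise disjoint, whereas neighbouring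
  closed cells share an edge.\<close>

definition core :: "nat \<times> nat \<Rightarrow> (real \<times> real) set" where
  "core = (\<lambda>(i, j). {a1 + (real i + 1/4) * H1..a1 + (real i + 3/4) * H1} \<times>
     {y0 + (real j + 1/4) * H2..y0 + (real j + 3/4) * H2})"

lemma cell_sets [measurable]: "cell k \<in> sets borel"
  by (simp add: cell_def case_prod_beta borel_closed closed_Times)

lemma core_sets [measurable]: "core k \<in> sets borel"
  by (simp add: core_def case_prod_beta borel_closed closed_Times)

lemma emeasure_cell: "emeasure lborel (cell k) = ennreal (H1 * H2)"
  using H_pos by (simp add: cell_def case_prod_beta emeasure_rectangle algebra_simps)

lemma emeasure_core: "emeasure lborel (core k) = ennreal (H1 * H2 / 4)"
proof -
  have "(a1 + (x + 3/4) * H1 - (a1 + (x + 1/4) * H1)) * (y0 + (y + 3/4) * H2 - (y0 + (y + 1/4) * H2)) = H1 * H2 / 4" for x y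
    by (simp add: algebra_simps)
  then show ?thesis
    using H_pos by (simp add: core_def case_prod_beta emeasure_rectangle mult_right_mono)
qed

lemma rescaled_bounds:
  assumes "0 < (H::real)"
  shows "c \<le> (x - x0) / H - i \<longleftrightarrow> x0 + (i + c) * H \<le> x" "(x - x0) / H - i \<le> c \<longleftrightarrow> x \<le> x0 + (i + c) * H"
  using assms by (auto simp: field_simps)

lemma pert_outside_cell:
  assumes "k \<in> cells" "z \<notin> cell k" shows "pert {k} z = 0"
proof (rule ccontr)
  assume nz: "pert {k} z \<noteq> 0"
  obtain i j where k: "k = (i, j)" "i < N1" "j < N2" using assms(1) by (auto simp: cells_def)
  have "g 0 ((fst z - a1) / H1 - real i) \<noteq> 0" "g 0 ((snd z - y0) / H2 - real j) \<noteq> 0"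
    using nz k by (auto simp: pert_singleton)
  from this[THEN g_supp] have "0 \<le> (fst z - a1) / H1 - real i" "(fst z - a1) / H1 - real i \<le> 1"
    "0 \<le> (snd z - y0) / H2 - real j" "(snd z - y0) / H2 - real j \<le> 1" by auto
  then have "z \<in> cell k"
    unfolding rescaled_bounds[OF H_pos(1)] rescaled_bounds[OF H_pos(2)]
    by (cases z) (simp add: k cell_def)
  with assms show False by simp
qed

lemma pert_core:
  assumes "k \<in> cells" "z \<in> core k" shows "a * m0\<^sup>2 \<le> pert {k} z"
proof -
  obtain i j where k: "k = (i, j)" "i < N1" "j < N2" using assms(1) by (auto simp: cells_def)
  have "1/4 \<le> (fst z - a1) / H1 - real i" "(fst z - a1) / H1 - real i \<le> 3/4"
    "1/4 \<le> (snd z - y0) / H2 - real j" "(snd z - y0) / H2 - real j \<le> 3/4"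
    unfolding rescaled_bounds[OF H_pos(1)] rescaled_bounds[OF H_pos(2)]
    using assms(2) by (cases z; simp add: k core_def)+
  then have "m0 * m0 \<le> g 0 ((fst z - a1) / H1 - real i) * g 0 ((snd z - y0) / H2 - real j)"
    using m0_pos by (intro mult_mono g_low) (auto simp: g_nonneg)
  then show ?thesis
    using a_nonneg k by (auto simp: pert_singleton power2_eq_square intro: mult_left_mono)
qed

lemma cell_subset:
  assumes "k \<in> cells" shows "cell k \<subseteq> {a1..b1} \<times> {y0..b2}"
proof -
  obtain i j where k: "k = (i, j)" "i < N1" "j < N2" using assms(1) by (auto simp: cells_def)
  have "(real i + 1) * H1 \<le> real N1 * H1" "(real j + 1) * H2 \<le> real N2 * H2"
    using k H_pos by (intro mult_right_mono; simp)+
  moreover have "real N1 * H1 = b1 - a1" "real N2 * H2 = b2 - y0"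
    using N_pos by (simp_all add: H1_def H2_def)
  moreover have "0 \<le> real i * H1" "0 \<le> real j * H2" using H_pos by simp_all
  ultimately show ?thesis by (auto simp: cell_def k)
qed

lemma core_subset_cell: "core k \<subseteq> cell k"
proof -
  have "(x + 1/4) * H1 \<ge> x * H1" "(x + 3/4) * H1 \<le> (x + 1) * H1"
    "(x + 1/4) * H2 \<ge> x * H2" "(x + 3/4) * H2 \<le> (x + 1) * H2" for x
    using H_pos by (simp_all add: mult_right_mono)
  then show ?thesis unfolding core_def cell_def case_prod_beta
    by (intro Sigma_mono) auto
qed

text \<open>After rescaling, indices whose cores share a point differ by at most \<open>1/2\<close>,
  so they coincide.\<close>

lemma core_disjoint:
  assumes "z \<in> core k" "z \<in> core k'" shows "k = k'"
proof -
  have *: "i = i'" if "0 < H" "x0 + (real i + 1/4) * H \<le> x" "x \<le> x0 + (real i + 3/4) * H"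
    "x0 + (real i' + 1/4) * H \<le> x" "x \<le> x0 + (real i' + 3/4) * H" for i i' :: nat and x0 x H :: real
    using that(2-5) unfolding rescaled_bounds[OF that(1), symmetric] by linarith
  show ?thesis
    using assms *[OF H_pos(1)] *[OF H_pos(2)] by (cases k; cases k'; cases z) (auto simp: core_def)
qed

lemma sum_indicator_core_le:
  assumes "a2 \<le> y0"
  shows "(\<Sum>k\<in>cells. indicator (core k) z :: ennreal) \<le> indicator ({a1..b1} \<times> {a2..b2}) z"
proof (cases "\<exists>k\<in>cells. z \<in> core k")
  case True
  then obtain k where k: "k \<in> cells" "z \<in> core k" by blast
  have "(\<Sum>k'\<in>cells. indicator (core k') z :: ennreal) = (\<Sum>k'\<in>cells. if k' = k then 1 else 0)"
    using core_disjoint[OF k(2)] k(2) by (intro sum.cong refl) (metis indicator_simps)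
  also have "\<dots> = 1" using k finite_cells by simp
  also have "\<dots> = indicator ({a1..b1} \<times> {a2..b2}) z"
    using k core_subset_cell[of k] cell_subset[of k] assms by (auto simp: indicator_def)
  finally show ?thesis by simp
qed (simp add: sum.neutral)

section \<open>Localised errors and Assouad's bound on the grid\<close>

definition local_err where
  "local_err n f G k S = (\<integral>\<^sup>+ \<omega>. (\<integral>\<^sup>+ z \<in> core k. ennreal ((G \<omega> z - hyp S z)\<^sup>2) \<partial>lborel) \<partial>sample_law n f (hyp S))"

text \<open>\<open>local_err\<close> plays the part of \<open>r k S\<close> in
  \<open>assouad\<close>; disjointness of the cores lets these errors add up inside the
  risk.\<close>

lemma sum_local_err_le_risk:
  assumes G: "G \<in> estimators n" and a2: "a2 \<le> y0"
  shows "(\<Sum>k\<in>cells. local_err n f G k S) \<le> risk n f ({a1..b1} \<times> {a2..b2}) G (hyp S)"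
proof -
  have "(\<Sum>k\<in>cells. local_err n f G k S) = (\<integral>\<^sup>+ \<omega>. (\<Sum>k\<in>cells. \<integral>\<^sup>+ z \<in> core k. ennreal ((G \<omega> z - hyp S z)\<^sup>2) \<partial>lborel) \<partial>sample_law n f (hyp S))"
    unfolding local_err_def using estimator_error_measurable[OF G]
    by (intro nn_integral_sum[symmetric]) simp
  also have "\<dots> \<le> risk n f ({a1..b1} \<times> {a2..b2}) G (hyp S)"
    unfolding risk_def
  proof (rule nn_integral_mono)
    fix \<omega> assume "\<omega> \<in> space (sample_law n f (hyp S))"
    then have [measurable]: "G \<omega> \<in> borel_measurable borel"
      using estimator_section_measurable[OF G] sets_eq_imp_space_eq[OF sets_sample_law] by auto
    have "(\<Sum>k\<in>cells. \<integral>\<^sup>+ z \<in> core k. ennreal ((G \<omega> z - hyp S z)\<^sup>2) \<partial>lborel)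
      = (\<integral>\<^sup>+ z. ennreal ((G \<omega> z - hyp S z)\<^sup>2) * (\<Sum>k\<in>cells. indicator (core k) z) \<partial>lborel)"
      unfolding sum_distrib_left by (rule nn_integral_sum[symmetric]) simp
    also have "\<dots> \<le> (\<integral>\<^sup>+ z \<in> {a1..b1} \<times> {a2..b2}. ennreal ((G \<omega> z - hyp S z)\<^sup>2) \<partial>lborel)"
      by (intro nn_integral_mono mult_left_mono sum_indicator_core_le a2) simp
    finally show "(\<Sum>k\<in>cells. \<integral>\<^sup>+ z \<in> core k. ennreal ((G \<omega> z - hyp S z)\<^sup>2) \<partial>lborel)
      \<le> (\<integral>\<^sup>+ z \<in> {a1..b1} \<times> {a2..b2}. ennreal ((G \<omega> z - hyp S z)\<^sup>2) \<partial>lborel)" .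
  qed
  finally show ?thesis .
qed

text \<open>Toggling bump \<open>k\<close> affects the law only through its cell, and
  \<open>small\<close> makes the two samples hard to distinguish. The \<open>16\<close> is
  \<open>2 * 4 * 2\<close>: squared-error separation, area of the core, affinity.\<close>

lemma local_err_pair:
  assumes G: "G \<in> estimators n" and f: "design_density f" and h: "AE z in lborel. f z \<le> h" "0 \<le> h"
    and k: "k \<in> cells" "k \<notin> S"
    and small: "real n * (h * (2 * a\<^sup>2 / (\<epsilon> * y0)) * (H1 * H2)) \<le> 1/2"
  shows "ennreal (a\<^sup>2 * m0 ^ 4 * (H1 * H2) / 16) \<le> local_err n f G k S + local_err n f G k (insert k S)"
proof -
  let ?F = "hyp S" and ?F' = "hyp (insert k S)"
  \<comment> \<open>On the cell \<open>F * (1 - F)\<close> is at least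
    \<open>\<epsilon> * y0 / 2\<close> and the change is at most \<open>a\<close>, which gives this
    quotient.\<close>
  let ?q = "2 * a\<^sup>2 / (\<epsilon> * y0)"
  have fm: "f \<in> borel_measurable borel" and f0: "\<And>z. 0 \<le> f z"
    using f unfolding design_density_def by (simp, blast)
  have q0: "0 \<le> ?q" using \<epsilon>_pos y0_pos by simp
  have diff: "?F' z - ?F z = (if snd z < b2 + 1 then pert {k} z else 0)" for z
    using pert_insert[OF k(2)] by (simp add: hyp_def)
  have out: "?F' z = ?F z" if "z \<notin> cell k" for z
    using diff[of z] pert_outside_cell[OF k(1) that] by (simp split: if_splits)
  have inn: "0 < ?F z \<and> ?F z < 1 \<and> (?F' z - ?F z)\<^sup>2 \<le> ?q * (?F z * (1 - ?F z))" if "z \<in> cell k" for z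
  proof -
    have y: "y0 \<le> snd z" "snd z \<le> b2" using cell_subset[OF k(1)] that by auto
    then have "\<epsilon> * y0 \<le> \<epsilon> * max 0 (snd z)" using \<epsilon>_pos by (intro mult_left_mono) auto
    then have lo: "\<epsilon> * y0 \<le> ?F z" using y pert_nonneg[of S z] by (simp add: hyp_def)
    have hi: "?F z \<le> 1/2" using line_le_half[of "snd z" S "fst z"] y by (simp add: hyp_def)
    have ey: "0 < \<epsilon> * y0" using \<epsilon>_pos y0_pos by simp
    have "(?F' z - ?F z)\<^sup>2 \<le> a\<^sup>2"
      using diff[of z] pert_le[of "{k}" z] pert_nonneg[of "{k}" z] by (auto intro: power_mono)
    also have "a\<^sup>2 = ?q * (\<epsilon> * y0 * (1/2))" using \<epsilon>_pos y0_pos by simp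
    also have "\<dots> \<le> ?q * (?F z * (1 - ?F z))"
      using lo hi ey q0 by (intro mult_left_mono mult_mono) auto
    finally show ?thesis using lo hi ey by simp
  qed
  have eq: "obs_law f ?F' = density (obs_law f ?F) (lik_ratio ?F ?F')"
  proof (rule obs_law_density[OF fm])
    fix z
    show "?F z = 0 \<Longrightarrow> ?F' z = 0" "?F z = 1 \<Longrightarrow> ?F' z = 1"
      using inn[of z] out[of z] by (cases "z \<in> cell k"; simp)+
  qed (auto simp: f0 hyp_bounds)
  have prob: "prob_space (obs_law f (hyp S))" for S
    by (rule prob_space_obs_law[OF f hyp_measurable hyp_bounds])
  have chi: "(\<integral>\<^sup>+ x. lik_ratio ?F ?F' x ^ 2 \<partial>obs_law f ?F) \<le> ennreal (1 + h * ?q * (H1 * H2))"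
    using H_pos by (intro chi_square_obs_law[where C="cell k"] f hyp_measurable cell_sets hyp_bounds out inn h q0 emeasure_cell) auto
  \<comment> \<open>The value \<infinity> off the sample space makes the separation hold for every
    \<omega>, as \<open>product_two_point_bound\<close> demands; measurability of
    \<open>G \<omega>\<close> is only available inside.\<close>
  let ?g = "\<lambda>F \<omega>. if \<omega> \<in> space (\<Pi>\<^sub>M i\<in>{..<n}. obs_space)
    then \<integral>\<^sup>+ z \<in> core k. ennreal ((G \<omega> z - F z)\<^sup>2) \<partial>lborel else \<infinity>"
  have sp: "space (\<Pi>\<^sub>M i\<in>{..<n}. obs_law f F) = space (\<Pi>\<^sub>M i\<in>{..<n}. obs_space)" for F
    by (simp add: space_PiM)
  have st: "sets (\<Pi>\<^sub>M i\<in>{..<n}. obs_law f F) = sets (\<Pi>\<^sub>M i\<in>{..<n}. obs_space)" for F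
    using sets_sample_law[of n f F] by (simp add: sample_law_def)
  have gm: "?g F \<in> borel_measurable (\<Pi>\<^sub>M i\<in>{..<n}. obs_law f F')"
    if "F \<in> borel_measurable borel" for F F'
  proof -
    have "?g F \<in> borel_measurable (\<Pi>\<^sub>M i\<in>{..<n}. obs_space)"
      using estimator_error_measurable[OF G that core_sets[of k]] by (rule measurable_cong[THEN iffD1, rotated]) simp
    then show ?thesis by (simp cong: measurable_cong_sets add: st)
  qed
  have "ennreal ((a * m0\<^sup>2)\<^sup>2 / 2 * (H1 * H2 / 4) / 2)
    \<le> (\<integral>\<^sup>+ \<omega>. ?g ?F \<omega> \<partial>PiM {..<n} (\<lambda>_. obs_law f ?F)) + (\<integral>\<^sup>+ \<omega>. ?g ?F' \<omega> \<partial>PiM {..<n} (\<lambda>_. obs_law f ?F'))"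
    unfolding eq
  proof (rule product_two_point_bound[OF _ _ _ chi])
    show "prob_space (density (obs_law f ?F) (lik_ratio ?F ?F'))" using prob by (simp flip: eq)
    show "lik_ratio ?F ?F' \<in> borel_measurable (obs_law f ?F)" by simp
    show "0 \<le> h * ?q * (H1 * H2)" using h q0 H_pos by (intro mult_nonneg_nonneg) auto
    fix \<omega>
    show "ennreal ((a * m0\<^sup>2)\<^sup>2 / 2 * (H1 * H2 / 4)) \<le> ?g ?F \<omega> + ?g ?F' \<omega>"
    proof (cases "\<omega> \<in> space (\<Pi>\<^sub>M i\<in>{..<n}. obs_space)")
      case True
      then have "G \<omega> \<in> borel_measurable borel" using estimator_section_measurable[OF G] by simp
      moreover have "a * m0\<^sup>2 \<le> \<bar>?F' z - ?F z\<bar>" if "z \<in> core k" for z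
        using pert_core[OF k(1) that] diff[of z] core_subset_cell[of k] cell_subset[OF k(1)] that by auto
      ultimately show ?thesis
        using True a_nonneg
          integrated_error_sum_ge[of "G \<omega>" ?F ?F' "core k", OF _ hyp_measurable hyp_measurable core_sets emeasure_core, of "a * m0\<^sup>2"]
        by simp
    qed simp
  qed (use prob small gm in auto)
  moreover have "(\<integral>\<^sup>+ \<omega>. ?g (hyp S) \<omega> \<partial>PiM {..<n} (\<lambda>_. obs_law f (hyp S))) = local_err n f G k S" for S
    unfolding local_err_def sample_law_def by (intro nn_integral_cong) (simp add: sp)
  moreover have "(a * m0\<^sup>2)\<^sup>2 / 2 * (H1 * H2 / 4) / 2 = a\<^sup>2 * m0 ^ 4 * (H1 * H2) / 16"
    by (simp add: power_mult_distrib flip: power_mult)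
  ultimately show ?thesis by (simp only:)
qed

text \<open>The number of cells times \<open>H1 * H2\<close> is the area of the perturbed half of
  the window, so \<open>N1\<close> and \<open>N2\<close> drop out. The factor \<open>X\<close> is
  the rate normalisation; \<open>32\<close> is \<open>16\<close> times the 2 from
  \<open>assouad\<close>.\<close>

lemma risk_lower_bound:
  assumes G: "G \<in> estimators n" and f: "design_density f" and h: "AE z in lborel. f z \<le> h" "0 \<le> h"
    and a2: "a2 \<le> y0" and "0 \<le> X"
    and small: "real n * (h * (2 * a\<^sup>2 / (\<epsilon> * y0)) * (H1 * H2)) \<le> 1/2"
    and R: "\<And>S. ennreal X * risk n f ({a1..b1} \<times> {a2..b2}) G (hyp S) \<le> R"
  shows "ennreal (X * a\<^sup>2 * (m0 ^ 4 * ((b1 - a1) * (b2 - y0)) / 32)) \<le> R"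
proof -
  let ?\<delta> = "a\<^sup>2 * m0 ^ 4 * (H1 * H2) / 16"
  have "of_nat (card cells) * ennreal (X * ?\<delta>) \<le> 2 * R"
  proof (rule assouad[OF finite_cells])
    fix k S assume kS: "k \<in> cells" "S \<subseteq> cells - {k}"
    then have "k \<notin> S" by auto
    from mult_left_mono[OF local_err_pair[OF G f h kS(1) this small], of "ennreal X"]
    show "ennreal (X * ?\<delta>) \<le> ennreal X * local_err n f G k S + ennreal X * local_err n f G k (insert k S)"
      unfolding ennreal_mult'[OF \<open>0 \<le> X\<close>] distrib_left by simp
  next
    fix S
    show "(\<Sum>k\<in>cells. ennreal X * local_err n f G k S) \<le> R"
      unfolding sum_distrib_left[symmetric]
      by (rule order_trans[OF mult_left_mono[OF sum_local_err_le_risk[OF G a2]] R]) simp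
  qed
  also have "of_nat (card cells) * ennreal (X * ?\<delta>) = ennreal (real (card cells) * (X * ?\<delta>))"
    using \<open>0 \<le> X\<close> by (subst ennreal_mult') (auto simp: ennreal_of_nat_eq_real_of_nat)
  also have "real (card cells) * (X * ?\<delta>) = X * a\<^sup>2 * m0 ^ 4 * ((N1 * H1) * (N2 * H2)) / 16"
    by (simp add: card_cells)
  also have "N1 * H1 = b1 - a1" using N_pos by (simp add: H1_def)
  also have "N2 * H2 = b2 - y0" using N_pos by (simp add: H2_def)
  also have "X * a\<^sup>2 * m0 ^ 4 * ((b1 - a1) * (b2 - y0)) / 16 = 2 * (X * a\<^sup>2 * (m0 ^ 4 * ((b1 - a1) * (b2 - y0)) / 32))"
    by simp
  finally show ?thesis
    by (simp only: ennreal_mult' ennreal_numeral zero_le_numeral)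
      (subst (asm) ennreal_mult_le_mult_iff; simp)
qed

end

text \<open>Rounding \<open>l / \<tau>\<close> up at most doubles it, because it is at least 1; so
  the side length lies within a factor 2 of the target \<tau>.\<close>

lemma ex_number_of_cells:
  fixes l \<tau> :: real
  assumes "0 < \<tau>" "1 \<le> l / \<tau>"
  obtains N :: nat where "0 < N" "\<tau> / 2 \<le> l / N" "l / N \<le> \<tau>"
proof
  let ?N = "nat \<lceil>l / \<tau>\<rceil>"
  have N: "l / \<tau> \<le> real ?N" "real ?N \<le> 2 * (l / \<tau>)" using assms by linarith+
  then show "0 < ?N" using assms by linarith
  then have N0: "0 < real ?N" by simp
  show "l / ?N \<le> \<tau>" using N(1) N0 assms by (simp add: field_simps)
  show "\<tau> / 2 \<le> l / ?N" using N(2) N0 assms by (simp add: field_simps)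
qed

theorem theorem3:
  fixes a1 b1 a2 b2 \<beta>1 \<beta>2 L h1 :: real
  assumes "a1 < b1" and "0 \<le> a2" and "a2 < b2"
    and "0 < \<beta>1" and "1 < \<beta>2" and "0 < L"
  defines "A \<equiv> {a1..b1} \<times> {a2..b2}"
    and "\<beta>bar \<equiv> 2 * \<beta>1 * \<beta>2 / (\<beta>1 + \<beta>2)"
  shows "\<exists>c > 0. \<forall>f. design_density f \<and> esssup lborel (\<lambda>z. ereal (f z)) = ereal h1 \<longrightarrow>
           (\<exists>n0. \<forall>n \<ge> n0.
              (INF G \<in> estimators n.
                 SUP F \<in> {F. cond_cdf F \<and> F \<in> besov_ball A \<beta>1 \<beta>2 L}.
                   ennreal (real n powr (\<beta>bar / (\<beta>bar + 1))) * risk n f A G F)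
              \<ge> ennreal c)"
proof -
  \<comment> \<open>One bump, smooth enough for the difference orders of both directions.\<close>
  define r where "r = Max {2, besov_order \<beta>1, besov_order \<beta>2}"
  have r: "2 \<le> r" "besov_order \<beta>1 \<le> r" "besov_order \<beta>2 \<le> r"
    by (simp_all add: r_def)
  obtain g :: "nat \<Rightarrow> real \<Rightarrow> real" and M m0 :: real where g:
    "\<And>k u. k < r \<Longrightarrow> (g k has_real_derivative g (Suc k) u) (at u)"
    "\<And>k u. g k u \<noteq> 0 \<Longrightarrow> 0 \<le> u \<and> u < 1"
    "\<And>k u. k \<le> r \<Longrightarrow> \<bar>g k u\<bar> \<le> M" "1 \<le> M"
    "\<And>u. 0 \<le> g 0 u" "\<And>u. g 0 u \<le> 1"
    "\<And>u. 1/4 \<le> u \<Longrightarrow> u \<le> 3/4 \<Longrightarrow> m0 \<le> g 0 u" "0 < m0"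
    using ex_smooth_bump by metis
  interpret smooth_bump g r M m0 using g r by unfold_locales
  define V where "V = sqrt ((b1 - a1) * (b2 - a2))"
  have V: "0 < V" using assms by (simp add: V_def)
  define y0 where "y0 = (a2 + b2) / 2"
  have y0: "0 < y0" "a2 \<le> y0" "y0 < b2" and b2: "0 < b2" using assms by (auto simp: y0_def)
  \<comment> \<open>The first term keeps the base at most \<open>1/2\<close>, the second gives it at
    most half of the Besov radius.\<close>
  define \<epsilon> where "\<epsilon> = min (1 / (2 * (b2 + 1))) (L / (2 * b2 * V))"
  have \<epsilon>: "0 < \<epsilon>" using b2 V assms by (simp add: \<epsilon>_def)
  have \<epsilon>1: "\<epsilon> * (b2 + 1) \<le> 1/2"
  proof -
    have "\<epsilon> \<le> 1 / (2 * (b2 + 1))" by (simp add: \<epsilon>_def)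
    then show ?thesis using b2 by (simp add: field_simps)
  qed
  have \<epsilon>2: "\<epsilon> * b2 * V \<le> L / 2"
    using mult_right_mono[of \<epsilon> "L / (2 * b2 * V)" "b2 * V"] b2 V by (simp add: \<epsilon>_def mult.assoc)
  define h where "h = \<bar>h1\<bar>"
  have h: "0 \<le> h" by (simp add: h_def)
  define C where "C = (2 * (M * 2 ^ r) + 1) * V"
  have C: "0 < C" unfolding C_def using V g(4) by (intro mult_pos_pos add_nonneg_pos) auto
  \<comment> \<open>After the normalisation \<open>1\<close>, the entries serve membership in the
    Besov ball, monotonicity in \<open>y\<close>, and the chi-square budget. They involve
    \<open>h1\<close> but neither \<open>f\<close> nor \<open>n\<close>, so \<open>c\<close> is
    uniform over the designs.\<close>
  define \<gamma> where "\<gamma> = Min {1, L / (2 * C), \<epsilon> / (2 * M), \<epsilon> * y0 / (4 * (h + 1))}"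
  have \<gamma>: "0 < \<gamma>" "\<gamma> \<le> 1" and \<gamma>L: "\<gamma> \<le> L / (2 * C)" and \<gamma>M: "\<gamma> \<le> \<epsilon> / (2 * M)" and \<gamma>h: "\<gamma> \<le> \<epsilon> * y0 / (4 * (h + 1))"
    using C g(4) \<epsilon> y0 h assms by (auto simp: \<gamma>_def)
  define c where "c = \<gamma>\<^sup>2 * (m0 ^ 4 * ((b1 - a1) * (b2 - y0)) / 32)"
  have c: "0 < c" using \<gamma> g(8) assms y0 by (simp add: c_def)
  have besov_const: "(2 * (\<gamma> * (M * 2 ^ r)) + (\<epsilon> * b2 + \<gamma>)) * V \<le> L"
  proof -
    have "\<gamma> * C \<le> L / 2" using mult_right_mono[OF \<gamma>L, of C] C by simp
    then show ?thesis using \<epsilon>2 by (simp add: C_def algebra_simps)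
  qed
  have \<gamma>2: "2 * \<gamma> * M \<le> \<epsilon>" using mult_right_mono[OF \<gamma>M, of "2 * M"] g(4) by (simp add: mult_ac)
  have chi_const: "h * (2 * \<gamma>\<^sup>2 / (\<epsilon> * y0)) \<le> 1/2"
  proof -
    have "\<gamma>\<^sup>2 * h \<le> \<gamma> * (h + 1)"
      unfolding power2_eq_square using \<gamma> h by (intro mult_mono) (auto simp: mult_left_le)
    also have "\<dots> \<le> \<epsilon> * y0 / 4"
      using \<gamma>h h pos_le_divide_eq[of "4 * (h + 1)" \<gamma> "\<epsilon> * y0"] by (simp add: algebra_simps)
    finally show ?thesis using \<epsilon> y0 by (simp add: divide_le_eq mult_ac)
  qed
  define D where "D = 2 + 1/\<beta>1 + 1/\<beta>2"
  have D: "0 < D" using assms by (simp add: D_def add_pos_pos)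
  have exponent: "\<beta>bar / (\<beta>bar + 1) = 2 / D"
  proof -
    define s p where "s = \<beta>1 + \<beta>2" and "p = \<beta>1 * \<beta>2"
    have sp: "0 < s" "0 < p" using assms(4,5) by (auto simp: s_def p_def)
    have "D = (2 * p + s) / p" using assms(4,5) by (simp add: D_def s_def p_def field_simps)
    moreover have "\<beta>bar = 2 * p / s" by (simp add: \<beta>bar_def s_def p_def)
    moreover have "2 * p / s + 1 = (2 * p + s) / s" using sp by (simp add: field_simps)
    ultimately show ?thesis using sp by simp
  qed
  \<comment> \<open>Solves \<open>n * \<sigma> powr D = 1\<close>: the exponent \<open>D\<close>
    adds the 2 from the squared height and \<open>1/\<beta>1 + 1/\<beta>2\<close> from the area of a
    cell.\<close>
  define \<sigma> where "\<sigma> n = real n powr (- (1 / D))" for n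
  have "\<forall>\<^sub>F n in sequentially. 1 \<le> l / \<sigma> n powr (1/\<beta>)" if "0 < l" "0 < \<beta>" for l \<beta>
  proof -
    have "((\<lambda>n. real n powr (- (1 / D * (1 / \<beta>)))) \<longlongrightarrow> 0) sequentially"
      using D that by (intro tendsto_neg_powr filterlim_real_sequentially) auto
    then have "\<forall>\<^sub>F n in sequentially. real n powr (- (1 / D * (1 / \<beta>))) < l"
      by (rule order_tendstoD) fact
    with eventually_ge_at_top[of 1] show ?thesis
      by eventually_elim (simp add: \<sigma>_def powr_powr pos_le_divide_eq)
  qed
  \<comment> \<open>For large \<open>n\<close> a target cell fits inside the perturbed rectangle in
    both directions; \<open>1 \<le> n\<close> also rules out the degenerate power
    \<open>0 powr x = 0\<close>.\<close>
  then have "\<forall>\<^sub>F n in sequentially. 1 \<le> (b1 - a1) / \<sigma> n powr (1/\<beta>1) \<and> 1 \<le> (b2 - y0) / \<sigma> n powr (1/\<beta>2) \<and> 1 \<le> n"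
    using assms y0 by (intro eventually_conj eventually_ge_at_top) auto
  then obtain n0 where n0: "\<And>n. n0 \<le> n \<Longrightarrow> 1 \<le> (b1 - a1) / \<sigma> n powr (1/\<beta>1) \<and> 1 \<le> (b2 - y0) / \<sigma> n powr (1/\<beta>2) \<and> 1 \<le> n"
    unfolding eventually_sequentially by blast
  show ?thesis
  proof (intro exI[of _ c] conjI c allI impI exI[of _ n0] INF_greatest)
    fix f n G
    assume f: "design_density f \<and> esssup lborel (\<lambda>z. ereal (f z)) = ereal h1"
      and n: "n0 \<le> n" and G: "G \<in> estimators n"
    have fh: "AE z in lborel. f z \<le> h"
      using esssup_AE[of "\<lambda>z. ereal (f z)" lborel] f by (auto simp: h_def elim!: eventually_mono)
    let ?\<sigma> = "\<sigma> n"
    have n1: "1 \<le> n" using n0[OF n] by simp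
    have \<sigma>: "0 < ?\<sigma>" "?\<sigma> \<le> 1"
      using n1 D powr_mono[of "- (1 / D)" 0 "real n"] by (auto simp: \<sigma>_def)
    have X: "real n powr (2 / D) * ?\<sigma>\<^sup>2 = 1"
      using n1 by (simp add: \<sigma>_def power2_eq_square flip: powr_add)
    have nn: "real n * (?\<sigma>\<^sup>2 * (?\<sigma> powr (1/\<beta>1) * ?\<sigma> powr (1/\<beta>2))) = 1"
    proof -
      have "?\<sigma>\<^sup>2 = ?\<sigma> powr 2" using \<sigma> by simp
      then have "?\<sigma>\<^sup>2 * (?\<sigma> powr (1/\<beta>1) * ?\<sigma> powr (1/\<beta>2)) = ?\<sigma> powr D"
        by (simp add: D_def add.assoc powr_add)
      also have "\<dots> = 1 / real n" using D n1 powr_minus_divide[of "real n" 1] by (simp add: \<sigma>_def powr_powr)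
      finally show ?thesis using n1 by simp
    qed
    obtain N1 :: nat where N1: "0 < N1" "?\<sigma> powr (1/\<beta>1) / 2 \<le> (b1 - a1) / N1" "(b1 - a1) / N1 \<le> ?\<sigma> powr (1/\<beta>1)"
      using ex_number_of_cells[of "?\<sigma> powr (1/\<beta>1)" "b1 - a1"] n0[OF n] \<sigma> by auto
    obtain N2 :: nat where N2: "0 < N2" "?\<sigma> powr (1/\<beta>2) / 2 \<le> (b2 - y0) / N2" "(b2 - y0) / N2 \<le> ?\<sigma> powr (1/\<beta>2)"
      using ex_number_of_cells[of "?\<sigma> powr (1/\<beta>2)" "b2 - y0"] n0[OF n] \<sigma> by auto
    define a where "a = \<gamma> * ?\<sigma>"
    interpret perturbation g r M m0 a1 b1 y0 b2 a \<epsilon> N1 N2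
    proof
      \<comment> \<open>Here \<open>1 < \<beta>2\<close> and \<sigma> at most 1 make the height
        small relative to the width in \<open>y\<close>; the 2 absorbs the rounding in the number of
        cells.\<close>
      have "?\<sigma> \<le> ?\<sigma> powr (1/\<beta>2)"
        using powr_mono'[of "1/\<beta>2" 1 ?\<sigma>] \<sigma> assms(5) by simp
      also have "\<dots> \<le> 2 * ((b2 - y0) / N2)" using N2(2) by linarith
      finally have "?\<sigma> * (N2 / (b2 - y0)) \<le> 2"
        using N2(1) y0 by (simp add: field_simps)
      then have "\<gamma> * M * (?\<sigma> * (N2 / (b2 - y0))) \<le> \<gamma> * M * 2"
        using \<gamma> g(4) by (intro mult_left_mono) auto
      then show "a * M * (N2 / (b2 - y0)) \<le> \<epsilon>" using \<gamma>2 by (simp add: a_def mult_ac)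
    qed (use assms y0 N1 N2 \<epsilon> \<epsilon>1 \<gamma> \<sigma> in \<open>auto simp: a_def\<close>)
    let ?R = "SUP F \<in> {F. cond_cdf F \<and> F \<in> besov_ball A \<beta>1 \<beta>2 L}.
                   ennreal (real n powr (\<beta>bar / (\<beta>bar + 1))) * risk n f A G F"
    have "ennreal (real n powr (2 / D) * a\<^sup>2 * (m0 ^ 4 * ((b1 - a1) * (b2 - y0)) / 32)) \<le> ?R"
    proof (rule risk_lower_bound[OF G _ fh h y0(2)])
      \<comment> \<open>The constant part is at most \<open>1/2\<close> by the choice of \<gamma>,
        and the part depending on \<open>n\<close> is at most 1 by \<open>nn\<close>.\<close>
      have "real n * (h * (2 * a\<^sup>2 / (\<epsilon> * y0)) * (H1 * H2))
        = (h * (2 * \<gamma>\<^sup>2 / (\<epsilon> * y0))) * (real n * (?\<sigma>\<^sup>2 * (H1 * H2)))"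
        by (simp add: a_def power_mult_distrib)
      also have "\<dots> \<le> 1/2 * (real n * (?\<sigma>\<^sup>2 * (?\<sigma> powr (1/\<beta>1) * ?\<sigma> powr (1/\<beta>2))))"
        using N1(3)[folded H1_def] N2(3)[folded H2_def] H_pos
        by (intro mult_mono chi_const order_refl mult_nonneg_nonneg) auto
      finally show "real n * (h * (2 * a\<^sup>2 / (\<epsilon> * y0)) * (H1 * H2)) \<le> 1/2" by (simp only: nn)
    next
      fix S
      have "hyp S \<in> besov_ball A \<beta>1 \<beta>2 L"
        unfolding A_def
        by (rule hyp_besov_ball[where \<gamma>=\<gamma> and \<sigma>="?\<sigma>"])
          (use assms r \<gamma> \<sigma> N1 N2 besov_const in \<open>auto simp: a_def H1_def H2_def V_def\<close>)
      then show "ennreal (real n powr (2 / D)) * risk n f ({a1..b1} \<times> {a2..b2}) G (hyp S) \<le> ?R"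
        unfolding exponent A_def[symmetric] by (intro SUP_upper) (simp add: cond_cdf_hyp)
    qed (use f in auto)
    also have "real n powr (2 / D) * a\<^sup>2 = \<gamma>\<^sup>2"
      using X by (simp add: a_def power_mult_distrib)
    finally show "ennreal c \<le> ?R" by (simp only: c_def)
  qed
qed

end
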